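(* Let $s_n$ be the number of weakly threshold sequences with $n$ terms and let $w_n$ be the number of isomorphism classes of weakly threshold graphs with $n$ vertices ($n\ge 1$). The generating function $S(x)=\sum_{n\ge 1}s_nx^n$ for the weakly threshold sequences, indexed by the number of terms, is \[S(x) = \frac{x-x^2-x^3}{1-3x+x^2+x^3} = -1 + \frac{1}{2(1-x)}+\frac{1-x}{2(1-2x-x^2)}.\] The generating function $W(x)=\sum_{n\ge 1}w_nx^n$ for the weakly threshold graphs, indexed by the number of vertices, is \[W(x) = \frac{x-2x^2-x^3-x^5}{1-4x+3x^2+x^3+x^5} = -1 + \frac{2}{3(1-x-x^2)} + \frac{1-2x}{3(1-3x+x^2-x^3)}.\]
   Context: Graphs are finite and simple, with at least one vertex. A degree sequence is the list $d=(d_1,\dots,d_n)$ of vertex degrees of a graph, written in nonincreasing order. For a degree sequence $d$ put $m(d)=\max\{i : d_i\ge i-1\}$ and, for $1\le k\le m(d)$, $\Delta_k(d)=k(k-1)+\sum_{i>k}\min\{k,d_i\}-\sum_{i=1}^k d_i$. A degree sequence $d$ is a weakly threshold sequence if $\Delta_k(d)\le 1$ for all $k\in\{1,\dots,m(d)\}$, and a weakly threshold graph is a graph whose degree sequence is weakly threshold. Graphs are counted up to isomorphism. *)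

theory Defs
  imports
    "HOL-Library.Multiset"
    "HOL-Computational_Algebra.Formal_Power_Series"
begin

type_synonym 'a ugraph = "'a set \<times> 'a set set"

abbreviation verts :: "'a ugraph \<Rightarrow> 'a set" where "verts \<equiv> fst"
abbreviation edges :: "'a ugraph \<Rightarrow> 'a set set" where "edges \<equiv> snd"

definition simple_graph :: "'a ugraph \<Rightarrow> bool" where
  "simple_graph G \<longleftrightarrow>
     finite (verts G) \<and> verts G \<noteq> {} \<and> (\<forall>e\<in>edges G. e \<subseteq> verts G \<and> card e = 2)"

definition degree :: "'a ugraph \<Rightarrow> 'a \<Rightarrow> nat" where
  "degree G v = card {e \<in> edges G. v \<in> e}"

definition graph_iso :: "'a ugraph \<Rightarrow> 'b ugraph \<Rightarrow> bool" where
  "graph_iso G H \<longleftrightarrow>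
     (\<exists>f. bij_betw f (verts G) (verts H) \<and>
          (\<forall>u\<in>verts G. \<forall>v\<in>verts G. {u, v} \<in> edges G \<longleftrightarrow> {f u, f v} \<in> edges H))"

definition deg_seq :: "'a ugraph \<Rightarrow> nat list" where
  "deg_seq G = rev (sorted_list_of_multiset (image_mset (degree G) (mset_set (verts G))))"

text \<open>Vertices are taken from the infinite type \<^typ>\<open>nat\<close>, so every finite graph has an
  isomorphic copy among the graphs considered.\<close>

definition degree_sequence :: "nat list \<Rightarrow> bool" where
  "degree_sequence d \<longleftrightarrow> (\<exists>G :: nat ugraph. simple_graph G \<and> deg_seq G = d)"

text \<open>The terms of a sequence are numbered from 1, as in $d = (d_1,\dots,d_n)$.\<close>

definition nth_term :: "nat list \<Rightarrow> nat \<Rightarrow> nat" where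
  "nth_term d i = d ! (i - 1)"

definition m_index :: "nat list \<Rightarrow> nat" where
  "m_index d = Max {i \<in> {1..length d}. nth_term d i \<ge> i - 1}"

definition Delta :: "nat \<Rightarrow> nat list \<Rightarrow> int" where
  "Delta k d = int k * (int k - 1) + (\<Sum>i\<in>{k<..length d}. int (min k (nth_term d i)))
                 - (\<Sum>i=1..k. int (nth_term d i))"

definition weakly_threshold_seq :: "nat list \<Rightarrow> bool" where
  "weakly_threshold_seq d \<longleftrightarrow> degree_sequence d \<and> (\<forall>k\<in>{1..m_index d}. Delta k d \<le> 1)"

definition weakly_threshold_graph :: "'a ugraph \<Rightarrow> bool" where
  "weakly_threshold_graph G \<longleftrightarrow> simple_graph G \<and> weakly_threshold_seq (deg_seq G)"

definition num_wt_seqs :: "nat \<Rightarrow> nat" where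
  "num_wt_seqs n = card {d. weakly_threshold_seq d \<and> length d = n}"

definition wt_graphs :: "nat \<Rightarrow> nat ugraph set" where
  "wt_graphs n = {G. weakly_threshold_graph G \<and> card (verts G) = n}"

definition num_wt_graphs :: "nat \<Rightarrow> nat" where
  "num_wt_graphs n =
     card (wt_graphs n // {(G, H). G \<in> wt_graphs n \<and> H \<in> wt_graphs n \<and> graph_iso G H})"

definition S_gf :: "rat fps" where
  "S_gf = Abs_fps (\<lambda>n. if n \<ge> 1 then of_nat (num_wt_seqs n) else 0)"

definition W_gf :: "rat fps" where
  "W_gf = Abs_fps (\<lambda>n. if n \<ge> 1 then of_nat (num_wt_graphs n) else 0)"

end

theory Submission
  imports Defs "HOL-Library.Product_Lexorder" "HOL-Library.Nat_Bijection"
begin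

text \<open>Let \<open>d\<close> be the degree sequence of a graph, listed along its vertices, and let \<open>T\<close> be the set of
the first \<open>k\<close> vertices. Double counting the edges that meet \<open>T\<close> shows that \<open>Delta k d\<close> is twice the
number of nonadjacent pairs in \<open>T\<close> plus, for each later vertex \<open>v\<close>, the deficit
\<open>min k (degree v)\<close> minus the number of neighbours of \<open>v\<close> in \<open>T\<close>. All these terms are nonnegative.

For \<open>k = m(d)\<close> the value is even, because of the handshake lemma, so the bound \<open>1\<close> forces it to be \<open>0\<close>:
the first \<open>m\<close> vertices \<open>\<alpha> 0, \<dots>, \<alpha> (m - 1)\<close> form a clique and the set \<open>B\<close> of all others is
independent. For smaller \<open>k\<close> the bound says that at most one vertex of \<open>B\<close> has a deficit at \<open>k\<close>,
and that this deficit is \<open>1\<close>. Hence a vertex of \<open>B\<close> with degree \<open>t\<close> is adjacent to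
\<open>\<alpha> 0, \<dots>, \<alpha> (t - 1)\<close>, or it has traded one of these for a single later \<open>\<alpha> j\<close>; and the intervals of
positions \<open>k\<close> at which two traders are in deficit are disjoint. Let \<open>\<tau> k\<close> be the degree of the vertex in
deficit at \<open>k\<close>, and \<open>0\<close> if there is none, and let \<open>c t\<close> be the number of vertices of \<open>B\<close> with degree
\<open>t\<close>. The graph is determined by \<open>m\<close>, \<open>c\<close> and \<open>\<tau>\<close>: these are the data of the locale \<open>swap_model\<close>, and
\<open>weakly_threshold_graph_model\<close> extracts them.

\<^bold>\<open>Sequences.\<close> The degrees depend on \<open>\<tau>\<close> only through the bits \<open>\<tau> k \<noteq> 0\<close>, and conversely these bits
are the numbers \<open>Delta k d\<close>. That the degrees are nonincreasing is a lower bound for each \<open>c t\<close> in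
terms of three consecutive bits (\<open>slack\<close> is nonnegative). Every choice subject to these bounds is
realised by a graph, so weakly threshold sequences are the words with letters \<open>(c t, bit t)\<close>
obeying them.

\<^bold>\<open>Graphs.\<close> Different \<open>\<tau>\<close> may give isomorphic graphs, because clique vertices with the same degree
may be listed in any order. Ties are broken by the sum of the degrees of the neighbours, in
decreasing order. For \<open>\<alpha> k\<close> this sum is a number determined by the degrees plus
\<open>\<tau> k - \<tau> (k + 1)\<close>. The sorted list of the pairs (degree, sum) is invariant under isomorphism, so by
telescoping it returns \<open>\<tau>\<close> (\<open>graph_iso_determines_track\<close>): isomorphism classes correspond to the \<open>\<tau>\<close>
for which ties are ordered in this way. Knowing at each \<open>k\<close> whether \<open>\<tau> k\<close> is \<open>0\<close>, larger than \<open>k\<close>, equal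
to \<open>k\<close> or smaller than \<open>k\<close> is enough to recover \<open>\<tau>\<close>, and the admissible choices are again words
with bounds on \<open>c t\<close> that depend on three consecutive letters.

Both kinds of words are counted by a transfer matrix: the generating functions of the words with a given
first letter and a given letter before it satisfy a finite linear system (\<open>chains_gf\<close>), which is solved by
elimination.\<close>

section \<open>Neighbours, degrees and the numbers Delta\<close>

definition nbrs :: "'a ugraph \<Rightarrow> 'a set \<Rightarrow> 'a \<Rightarrow> nat" where
  "nbrs G T v = card {u \<in> T. {u, v} \<in> edges G}"

lemma simple_graphD:
  assumes "simple_graph G"
  shows "finite (verts G)" "verts G \<noteq> {}" "\<And>u v. {u, v} \<in> edges G \<Longrightarrow> u \<noteq> v \<and> u \<in> verts G \<and> v \<in> verts G"
proof -
  show "finite (verts G)" "verts G \<noteq> {}" using assms by (auto simp: simple_graph_def)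
  fix u v assume "{u, v} \<in> edges G"
  then have "{u, v} \<subseteq> verts G \<and> card {u, v} = 2" using assms by (auto simp: simple_graph_def)
  then show "u \<noteq> v \<and> u \<in> verts G \<and> v \<in> verts G" by (cases "u = v") auto
qed

lemma degree_eq_nbrs:
  assumes "simple_graph G"
  shows "degree G v = nbrs G (verts G) v"
proof -
  have "{e \<in> edges G. v \<in> e} = (\<lambda>u. {u, v}) ` {u \<in> verts G. {u, v} \<in> edges G}" (is "?L = ?R")
  proof
    show "?L \<subseteq> ?R"
    proof
      fix e assume e: "e \<in> ?L"
      then have "card e = 2" "e \<subseteq> verts G" using assms by (auto simp: simple_graph_def)
      then obtain x y where xy: "e = {x, y}" "x \<noteq> y" by (auto simp: card_2_iff)
      then consider "v = x" | "v = y" using e by auto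
      then obtain u where u: "e = {u, v}" using xy by cases auto
      then have "u \<in> verts G" using \<open>e \<subseteq> verts G\<close> by auto
      then show "e \<in> ?R" using u e by blast
    qed
    show "?R \<subseteq> ?L" by auto
  qed
  moreover have "inj_on (\<lambda>u. {u, v}) {u \<in> verts G. {u, v} \<in> edges G}"
    by (auto simp: inj_on_def doubleton_eq_iff)
  ultimately show ?thesis by (simp add: degree_def nbrs_def card_image)
qed

lemma int_nbrs:
  assumes "finite T"
  shows "int (nbrs G T v) = (\<Sum>u\<in>T. of_bool ({u, v} \<in> edges G))"
  using assms by (simp add: nbrs_def sum.If_cases of_bool_def Int_def)

lemma nbrs_mono: "finite T' \<Longrightarrow> T \<subseteq> T' \<Longrightarrow> nbrs G T v \<le> nbrs G T' v"
  unfolding nbrs_def by (rule card_mono) auto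

lemma nbrs_le_card: "finite T \<Longrightarrow> nbrs G T v \<le> card T"
  unfolding nbrs_def by (rule card_mono) auto

lemma nbrs_Un_disjoint:
  assumes "finite S" "finite T" "S \<inter> T = {}"
  shows "nbrs G (S \<union> T) v = nbrs G S v + nbrs G T v"
proof -
  have "{u \<in> S \<union> T. {u, v} \<in> edges G} = {u \<in> S. {u, v} \<in> edges G} \<union> {u \<in> T. {u, v} \<in> edges G}" by auto
  then show ?thesis unfolding nbrs_def using assms by (subst card_Un_disjoint[symmetric]) auto
qed

lemma nbrs_self_bound:
  assumes "simple_graph G" "finite T" "v \<in> T"
  shows "nbrs G T v \<le> card T - 1"
proof -
  have "{u \<in> T. {u, v} \<in> edges G} \<subseteq> T - {v}" using simple_graphD(3)[OF assms(1)] by auto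
  then have "nbrs G T v \<le> card (T - {v})" unfolding nbrs_def using assms by (intro card_mono) auto
  then show ?thesis using assms by simp
qed

lemma sum_nbrs_swap:
  assumes "finite S" "finite T"
  shows "(\<Sum>v\<in>S. int (nbrs G T v)) = (\<Sum>u\<in>T. int (nbrs G S u))"
  unfolding int_nbrs[OF assms(1)] int_nbrs[OF assms(2)]
  by (subst sum.swap) (simp add: insert_commute)

lemma even_sum_nbrs:
  assumes "simple_graph G" "finite T"
  shows "even (\<Sum>v\<in>T. int (nbrs G T v))"
  using assms(2)
proof (induction T rule: finite_induct)
  case (insert x T)
  have *: "nbrs G (insert x T) v = nbrs G T v + of_bool ({x, v} \<in> edges G)" for v
  proof -
    have "{u \<in> {x}. {u, v} \<in> edges G} = (if {x, v} \<in> edges G then {x} else {})" by auto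
    then have "nbrs G {x} v = of_bool ({x, v} \<in> edges G)" by (simp add: nbrs_def)
    then show ?thesis using nbrs_Un_disjoint[of "{x}" T G v] insert by simp
  qed
  have "{x} \<notin> edges G" using simple_graphD(3)[OF assms(1), of x x] by auto
  then have "(\<Sum>v\<in>insert x T. int (nbrs G (insert x T) v))
      = int (nbrs G T x) + (\<Sum>v\<in>T. int (nbrs G T v)) + (\<Sum>v\<in>T. of_bool ({x, v} \<in> edges G))"
    using insert by (simp add: * sum.distrib)
  also have "(\<Sum>v\<in>T. of_bool ({x, v} \<in> edges G)) = int (nbrs G T x)"
    using insert by (simp add: int_nbrs insert_commute)
  finally show ?case using insert by simp
qed simp

lemma length_deg_seq_verts: "length (deg_seq G) = card (verts G)"
  by (metis deg_seq_def length_rev mset_sorted_list_of_multiset size_image_mset size_mset size_mset_set)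

lemma deg_seq_eqI:
  assumes "distinct vs" "set vs = verts G" "sorted_wrt (\<ge>) (map (degree G) vs)"
  shows "deg_seq G = map (degree G) vs"
proof -
  have m: "mset vs = mset_set (verts G)" using assms(1,2) mset_set_set by metis
  have "sort (rev (map (degree G) vs)) = rev (map (degree G) vs)"
    using assms(3) by (intro sorted_sort_id) (simp add: sorted_wrt_rev)
  moreover have "sorted_list_of_multiset (mset (rev (map (degree G) vs))) = sort (rev (map (degree G) vs))"
    by (rule sorted_list_of_multiset_mset)
  moreover have "mset (rev (map (degree G) vs)) = image_mset (degree G) (mset_set (verts G))"
    by (simp flip: m)
  ultimately have "sorted_list_of_multiset (image_mset (degree G) (mset_set (verts G))) = rev (map (degree G) vs)"
    by metis
  then show ?thesis by (simp add: deg_seq_def)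
qed

text \<open>The degrees of the vertices in \<open>T\<close> add up to twice the number of edges inside \<open>T\<close> plus the number of
edges leaving \<open>T\<close>, and the latter are counted once more from their other ends. Each summand counts
missing neighbours, so it is nonnegative.\<close>

lemma Delta_eq_sum_defects:
  assumes G: "simple_graph G" and vs: "distinct vs" "set vs = verts G" and k: "k \<le> length vs"
    and T: "T = set (take k vs)"
  shows "Delta k (map (degree G) vs) =
    (\<Sum>v\<in>T. int k - 1 - int (nbrs G T v)) +
    (\<Sum>v\<in>verts G - T. int (min k (degree G v)) - int (nbrs G T v))"
proof -
  let ?d = "map (degree G) vs"
  have fin: "finite (verts G)" using simple_graphD[OF G] by simp
  have fT: "finite T" and TV: "T \<subseteq> verts G" and cT: "card T = k"
    using T vs k set_take_subset[of k vs] by (auto simp: distinct_card)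
  have T': "T = (!) vs ` {..<k}" using nth_image[OF k] T by (simp add: lessThan_atLeast0)
  have D': "verts G - T = (!) vs ` {k..<length vs}"
  proof -
    have inj: "inj_on ((!) vs) {..<length vs}" using vs(1) by (auto simp: inj_on_def nth_eq_iff_index_eq)
    have "verts G = (!) vs ` {..<length vs}" using vs(2) by (auto simp: set_conv_nth)
    moreover have "(!) vs ` ({..<length vs} - {..<k}) = (!) vs ` {..<length vs} - (!) vs ` {..<k}"
      by (rule inj_on_image_set_diff[OF inj]) (use k in auto)
    ultimately have "verts G - T = (!) vs ` ({..<length vs} - {..<k})" unfolding T' by metis
    also have "{..<length vs} - {..<k} = {k..<length vs}" by auto
    finally show ?thesis .
  qed
  have s1: "(\<Sum>i=1..k. int (nth_term ?d i)) = (\<Sum>v\<in>T. int (degree G v))"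
  proof -
    have "(\<Sum>i=1..k. int (nth_term ?d i)) = (\<Sum>i<k. int (degree G (vs ! i)))"
      by (rule sum.reindex_bij_witness[of _ Suc "\<lambda>i. i - 1"]) (use k in \<open>auto simp: nth_term_def\<close>)
    also have "\<dots> = (\<Sum>v\<in>T. int (degree G v))" unfolding T'
      by (subst sum.reindex) (use vs k in \<open>auto simp: inj_on_def nth_eq_iff_index_eq\<close>)
    finally show ?thesis .
  qed
  have s2: "(\<Sum>i\<in>{k<..length ?d}. int (min k (nth_term ?d i))) = (\<Sum>v\<in>verts G - T. int (min k (degree G v)))"
  proof -
    have "(\<Sum>i\<in>{k<..length ?d}. int (min k (nth_term ?d i))) = (\<Sum>i\<in>{k..<length vs}. int (min k (degree G (vs ! i))))"
      by (rule sum.reindex_bij_witness[of _ Suc "\<lambda>i. i - 1"]) (auto simp: nth_term_def)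
    also have "\<dots> = (\<Sum>v\<in>verts G - T. int (min k (degree G v)))" unfolding D'
      by (subst sum.reindex) (use vs in \<open>auto simp: inj_on_def nth_eq_iff_index_eq\<close>)
    finally show ?thesis .
  qed
  have V: "verts G = T \<union> (verts G - T)" using TV by auto
  have "(\<Sum>v\<in>T. int (degree G v)) = (\<Sum>v\<in>T. int (nbrs G T v)) + (\<Sum>v\<in>T. int (nbrs G (verts G - T) v))"
    unfolding degree_eq_nbrs[OF G]
    by (subst V, subst nbrs_Un_disjoint) (use fin fT in \<open>auto simp: sum.distrib\<close>)
  also have "(\<Sum>v\<in>T. int (nbrs G (verts G - T) v)) = (\<Sum>v\<in>verts G - T. int (nbrs G T v))"
    by (rule sum_nbrs_swap) (use fin fT in auto)
  finally have s3: "(\<Sum>v\<in>T. int (degree G v)) = (\<Sum>v\<in>T. int (nbrs G T v)) + (\<Sum>v\<in>verts G - T. int (nbrs G T v))" .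
  show ?thesis unfolding Delta_def s1 s2 s3 using cT
    by (simp add: sum_subtractf sum.distrib algebra_simps)
qed

section \<open>The data of a split graph in which neighbourhoods are nested up to disjoint swaps\<close>

text \<open>The values \<open>\<tau> k\<close> for \<open>k < m\<close>: the degree of the vertex in deficit at \<open>k\<close>, or \<open>0\<close>. A vertex of
degree \<open>t\<close> that trades \<open>\<alpha> i\<close> for \<open>\<alpha> j\<close> is in deficit exactly for \<open>i < k \<le> j\<close>, an interval that contains
\<open>t\<close>. So from a position with value \<open>t\<close> the value must persist in the direction of \<open>t\<close>.\<close>

definition swap_track :: "nat \<Rightarrow> (nat \<Rightarrow> nat) \<Rightarrow> bool" where
  "swap_track m \<tau> \<longleftrightarrow> \<tau> 0 = 0 \<and> (\<forall>k\<ge>m. \<tau> k = 0) \<and> (\<forall>k. k < \<tau> k \<longrightarrow> \<tau> (Suc k) = \<tau> k)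
     \<and> (\<forall>k. 0 < \<tau> (Suc k) \<and> \<tau> (Suc k) < Suc k \<longrightarrow> \<tau> k = \<tau> (Suc k))"

lemma swap_track_fixed:
  assumes t: "swap_track m \<tau>" and nz: "\<tau> k \<noteq> 0"
  shows "\<tau> (\<tau> k) = \<tau> k"
proof (cases "k \<le> \<tau> k")
  case True
  have "\<tau> l = \<tau> k" if "k \<le> l" "l \<le> \<tau> k" for l
    using that
  proof (induction l rule: dec_induct)
    case (step n)
    then have "\<tau> n = \<tau> k" "n < \<tau> n" by auto
    then show ?case using t unfolding swap_track_def by metis
  qed simp
  then show ?thesis using True by blast
next
  case False
  have "\<tau> k \<le> k" using False by simp
  moreover have "\<tau> l = \<tau> k" if "l \<le> k" "\<tau> k \<le> l" for l
    using that
  proof (induction l rule: inc_induct)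
    case (step n)
    then have "\<tau> (Suc n) = \<tau> k" "0 < \<tau> (Suc n)" "\<tau> (Suc n) < Suc n" using nz by auto
    then show ?case using t unfolding swap_track_def by metis
  qed simp
  ultimately show ?thesis by blast
qed

text \<open>The drop in degree from \<open>\<alpha> k\<close> to \<open>\<alpha> (k + 1)\<close>: there are \<open>c (k + 1)\<close> vertices in \<open>B\<close> that are
adjacent to the first and not to the second, up to the effect of the swaps.\<close>

definition slack :: "(nat \<Rightarrow> nat) \<Rightarrow> (nat \<Rightarrow> nat) \<Rightarrow> nat \<Rightarrow> int" where
  "slack c \<tau> k = int (c (Suc k)) + of_bool (\<tau> k \<noteq> 0) + of_bool (\<tau> (Suc (Suc k)) \<noteq> 0) - 2 * of_bool (\<tau> (Suc k) \<noteq> 0)"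

text \<open>The same drop when each vertex of \<open>B\<close> counts with its degree. If the degrees of \<open>\<alpha> k\<close> and
\<open>\<alpha> (k + 1)\<close> agree, it is the drop in the sum of the degrees of the neighbours.\<close>

definition tie_slack :: "(nat \<Rightarrow> nat) \<Rightarrow> (nat \<Rightarrow> nat) \<Rightarrow> nat \<Rightarrow> int" where
  "tie_slack c \<tau> k = int (Suc k * c (Suc k)) + int (\<tau> k) + int (\<tau> (Suc (Suc k))) - 2 * int (\<tau> (Suc k))"

definition neighbour_degree_sum :: "'a ugraph \<Rightarrow> 'a \<Rightarrow> nat" where
  "neighbour_degree_sum G v = (\<Sum>u\<in>{u \<in> verts G. {u, v} \<in> edges G}. degree G u)"

lemma int_neighbour_degree_sum:
  "finite (verts G) \<Longrightarrow> int (neighbour_degree_sum G v) = (\<Sum>u\<in>verts G. int (degree G u) * of_bool ({u, v} \<in> edges G))"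
  by (simp add: neighbour_degree_sum_def of_bool_def if_distrib sum.If_cases Int_def cong: if_cong)

text \<open>\<open>P\<close> is the set of vertices that have traded a neighbour. The last condition states that the
deficit of \<open>u\<close> at \<open>k\<close> is \<open>1\<close> if \<open>u \<in> P\<close> and \<open>\<tau> k = degree G u\<close>, and \<open>0\<close> otherwise, by giving
its change from \<open>k\<close> to \<open>k + 1\<close>.\<close>

locale swap_model =
  fixes G :: "'a ugraph" and m :: nat and c \<tau> :: "nat \<Rightarrow> nat" and \<alpha> :: "nat \<Rightarrow> 'a" and P :: "'a set"
  assumes simple: "simple_graph G"
    and m_pos: "0 < m"
    and track: "swap_track m \<tau>"
    and inj: "inj_on \<alpha> {..<m}"
    and sub: "\<alpha> ` {..<m} \<subseteq> verts G"
    and clique: "\<And>i j. i < m \<Longrightarrow> j < m \<Longrightarrow> i \<noteq> j \<Longrightarrow> {\<alpha> i, \<alpha> j} \<in> edges G"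
    and indep: "\<And>u v. u \<in> verts G - \<alpha> ` {..<m} \<Longrightarrow> v \<in> verts G - \<alpha> ` {..<m} \<Longrightarrow> {u, v} \<notin> edges G"
    and small: "\<And>u. u \<in> verts G - \<alpha> ` {..<m} \<Longrightarrow> degree G u < m"
    and count: "\<And>t. t < m \<Longrightarrow> card {u \<in> verts G - \<alpha> ` {..<m}. degree G u = t} = c t"
    and P_sub: "P \<subseteq> verts G - \<alpha> ` {..<m}"
    and P_inj: "inj_on (degree G) P"
    and P_deg: "degree G ` P = {t. 0 < t \<and> \<tau> t = t}"
    and adj: "\<And>u k. u \<in> verts G - \<alpha> ` {..<m} \<Longrightarrow> k < m \<Longrightarrow>
      of_bool ({\<alpha> k, u} \<in> edges G) = of_bool (k < degree G u) + of_bool (u \<in> P \<and> \<tau> k = degree G u)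
        - (of_bool (u \<in> P \<and> \<tau> (Suc k) = degree G u) :: int)"
begin

abbreviation "A \<equiv> \<alpha> ` {..<m}"
abbreviation "B \<equiv> verts G - A"

lemma fin: "finite (verts G)" "finite A" "finite B"
  using simple_graphD[OF simple] by auto

lemma verts_split: "verts G = A \<union> B" using sub by auto

lemma card_A: "card A = m" by (simp add: card_image inj)

lemma sum_B:
  fixes h :: "nat \<Rightarrow> int"
  shows "(\<Sum>u\<in>B. h (degree G u)) = (\<Sum>t<m. int (c t) * h t)"
proof -
  have "(\<Sum>u\<in>B. h (degree G u)) = (\<Sum>t<m. \<Sum>u\<in>{u \<in> B. degree G u = t}. h (degree G u))"
    by (rule sum.group[symmetric]) (use fin small in auto)
  also have "\<dots> = (\<Sum>t<m. \<Sum>u\<in>{u \<in> B. degree G u = t}. h t)" by simp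
  also have "\<dots> = (\<Sum>t<m. int (c t) * h t)" by (intro sum.cong refl) (simp only: sum_constant count lessThan_iff)
  finally show ?thesis .
qed

text \<open>Exactly one vertex of \<open>P\<close> has degree \<open>\<tau> k\<close> when \<open>\<tau> k\<close> is nonzero, since then \<open>\<tau> (\<tau> k) = \<tau> k\<close>.\<close>

lemma sum_special:
  fixes h :: "nat \<Rightarrow> int"
  shows "(\<Sum>u\<in>B. h (degree G u) * of_bool (u \<in> P \<and> \<tau> k = degree G u)) = of_bool (\<tau> k \<noteq> 0) * h (\<tau> k)"
proof (cases "\<tau> k = 0")
  case True
  have "0 \<notin> degree G ` P" unfolding P_deg by simp
  then have *: "(u \<in> P \<and> \<tau> k = degree G u) = False" for u using True by force
  show ?thesis by (simp only: *) (simp add: True)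
next
  case False
  then have "\<tau> k \<in> degree G ` P" using swap_track_fixed[OF track] unfolding P_deg by auto
  then obtain p where p: "p \<in> P" "\<tau> k = degree G p" by auto
  then have "u \<in> P \<and> \<tau> k = degree G u \<longleftrightarrow> u = p" for u using P_inj by (auto simp: inj_on_def)
  then have "(\<Sum>u\<in>B. h (degree G u) * of_bool (u \<in> P \<and> \<tau> k = degree G u)) = (\<Sum>u\<in>B. if u = p then h (\<tau> k) else 0)"
    using p by (intro sum.cong) auto
  also have "\<dots> = h (\<tau> k)" using p P_sub fin by (subst sum.delta) auto
  finally show ?thesis using False by simp
qed

text \<open>Used with \<open>h = (\<lambda>_. 1)\<close> for the degree of \<open>\<alpha> k\<close> and with the inclusion of the naturals for the sum of the
degrees of its neighbours.\<close>

lemma sum_adj: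
  fixes h :: "nat \<Rightarrow> int"
  assumes k: "k < m"
  shows "(\<Sum>u\<in>B. h (degree G u) * of_bool ({\<alpha> k, u} \<in> edges G)) =
     (\<Sum>t\<in>{k<..<m}. int (c t) * h t) + of_bool (\<tau> k \<noteq> 0) * h (\<tau> k) - of_bool (\<tau> (Suc k) \<noteq> 0) * h (\<tau> (Suc k))"
proof -
  have "(\<Sum>u\<in>B. h (degree G u) * of_bool ({\<alpha> k, u} \<in> edges G)) =
    (\<Sum>u\<in>B. (h (degree G u) * of_bool (k < degree G u)) + h (degree G u) * of_bool (u \<in> P \<and> \<tau> k = degree G u)
       - h (degree G u) * of_bool (u \<in> P \<and> \<tau> (Suc k) = degree G u))"
    by (intro sum.cong refl) (simp only: adj k ring_distribs)
  also have "\<dots> = (\<Sum>u\<in>B. h (degree G u) * of_bool (k < degree G u)) + of_bool (\<tau> k \<noteq> 0) * h (\<tau> k) - of_bool (\<tau> (Suc k) \<noteq> 0) * h (\<tau> (Suc k))"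
    by (simp only: sum.distrib sum_subtractf sum_special)
  also have "(\<Sum>u\<in>B. h (degree G u) * of_bool (k < degree G u)) = (\<Sum>t<m. int (c t) * (h t * of_bool (k < t)))"
    by (rule sum_B)
  also have "\<dots> = (\<Sum>t\<in>{k<..<m}. int (c t) * h t)"
    by (rule sum.mono_neutral_cong_right) auto
  finally show ?thesis .
qed

lemma nbrs_A_clique: "k < m \<Longrightarrow> nbrs G A (\<alpha> k) = m - 1"
proof -
  assume k: "k < m"
  have "{u \<in> A. {u, \<alpha> k} \<in> edges G} = A - {\<alpha> k}"
  proof -
    have "{\<alpha> i, \<alpha> k} \<in> edges G \<longleftrightarrow> \<alpha> i \<noteq> \<alpha> k" if "i < m" for i
      using that k clique[of i k] simple_graphD(3)[OF simple, of "\<alpha> i" "\<alpha> k"] by auto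
    then show ?thesis by auto
  qed
  then show ?thesis using k by (simp add: nbrs_def card_A fin)
qed

lemma degree_clique:
  assumes k: "k < m"
  shows "int (degree G (\<alpha> k)) = int m - 1 + (\<Sum>t\<in>{k<..<m}. int (c t)) + of_bool (\<tau> k \<noteq> 0) - of_bool (\<tau> (Suc k) \<noteq> 0)"
proof -
  have "degree G (\<alpha> k) = nbrs G A (\<alpha> k) + nbrs G B (\<alpha> k)"
    unfolding degree_eq_nbrs[OF simple] by (subst verts_split, rule nbrs_Un_disjoint) (use fin in auto)
  moreover have "int (nbrs G B (\<alpha> k)) = (\<Sum>u\<in>B. 1 * of_bool ({\<alpha> k, u} \<in> edges G))"
    by (simp add: int_nbrs fin insert_commute)
  ultimately show ?thesis using sum_adj[OF k, of "\<lambda>_. 1"] nbrs_A_clique[OF k] k by (simp add: of_nat_diff)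
qed

lemma neighbour_degree_sum_clique:
  assumes k: "k < m"
  shows "int (neighbour_degree_sum G (\<alpha> k)) = (\<Sum>i<m. int (degree G (\<alpha> i))) - int (degree G (\<alpha> k))
     + (\<Sum>t\<in>{k<..<m}. int (c t * t)) + int (\<tau> k) - int (\<tau> (Suc k))"
proof -
  have "int (neighbour_degree_sum G (\<alpha> k)) = (\<Sum>u\<in>A. int (degree G u) * of_bool ({u, \<alpha> k} \<in> edges G))
      + (\<Sum>u\<in>B. int (degree G u) * of_bool ({\<alpha> k, u} \<in> edges G))"
    unfolding int_neighbour_degree_sum[OF fin(1)]
    by (subst verts_split, subst sum.union_disjoint) (use fin in \<open>auto simp: insert_commute\<close>)
  also have "(\<Sum>u\<in>A. int (degree G u) * of_bool ({u, \<alpha> k} \<in> edges G)) = (\<Sum>i<m. int (degree G (\<alpha> i)) * of_bool ({\<alpha> i, \<alpha> k} \<in> edges G))"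
    by (simp add: sum.reindex[OF inj])
  also have "\<dots> = (\<Sum>i\<in>{..<m} - {k}. int (degree G (\<alpha> i)))"
    by (rule sum.mono_neutral_cong_right)
      (use k clique simple_graphD(3)[OF simple, of "\<alpha> k" "\<alpha> k"] in auto)
  also have "\<dots> = (\<Sum>i<m. int (degree G (\<alpha> i))) - int (degree G (\<alpha> k))"
    using k by (simp add: sum_diff1)
  finally show ?thesis using sum_adj[OF k, of int] by (auto simp: of_bool_def)
qed

lemma sum_greaterThanLessThan_Suc:
  fixes f :: "nat \<Rightarrow> int"
  assumes "Suc k < m"
  shows "(\<Sum>t\<in>{k<..<m}. f t) = f (Suc k) + (\<Sum>t\<in>{Suc k<..<m}. f t)"
proof -
  have "{k<..<m} = insert (Suc k) {Suc k<..<m}" using assms by auto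
  then show ?thesis by simp
qed

lemma degree_clique_diff:
  assumes "Suc k < m"
  shows "int (degree G (\<alpha> k)) - int (degree G (\<alpha> (Suc k))) = slack c \<tau> k"
  using assms by (simp add: degree_clique sum_greaterThanLessThan_Suc slack_def)

lemma neighbour_degree_sum_clique_diff:
  assumes "Suc k < m"
  shows "int (neighbour_degree_sum G (\<alpha> k)) - int (neighbour_degree_sum G (\<alpha> (Suc k))) = tie_slack c \<tau> k - slack c \<tau> k"
  using assms degree_clique_diff[OF assms]
  by (simp add: neighbour_degree_sum_clique sum_greaterThanLessThan_Suc tie_slack_def algebra_simps)

lemma nbrs_initial:
  assumes u: "u \<in> B" and k: "k \<le> m"
  shows "int (nbrs G (\<alpha> ` {..<k}) u) = int (min k (degree G u)) - of_bool (u \<in> P \<and> \<tau> k = degree G u)"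
  using k
proof (induction k)
  case 0
  have "0 \<notin> degree G ` P" unfolding P_deg by simp
  then have "\<not> (u \<in> P \<and> degree G u = 0)" by force
  then show ?case using track by (auto simp: nbrs_def swap_track_def)
next
  case (Suc k)
  have "\<alpha> k \<notin> \<alpha> ` {..<k}" using inj_onD[OF inj, of k] Suc.prems by fastforce
  then have "int (nbrs G (\<alpha> ` {..<Suc k}) u) = int (nbrs G (\<alpha> ` {..<k}) u) + of_bool ({\<alpha> k, u} \<in> edges G)"
    by (simp add: int_nbrs lessThan_Suc)
  then show ?case using Suc adj[OF u, of k] by auto
qed

lemma degree_clique_ge: "k < m \<Longrightarrow> (\<And>k. Suc k < m \<Longrightarrow> 0 \<le> slack c \<tau> k) \<Longrightarrow> m - 1 \<le> degree G (\<alpha> k)"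
proof -
  assume k: "k < m" and s: "\<And>k. Suc k < m \<Longrightarrow> 0 \<le> slack c \<tau> k"
  have "k \<le> m - 1" using k by simp
  then show ?thesis
  proof (induction k rule: inc_induct)
    case base
    have "{m - 1<..<m} = {}" by auto
    moreover have "\<tau> m = 0" using track by (simp add: swap_track_def)
    ultimately show ?case using degree_clique[of "m - 1"] m_pos by (auto simp: of_bool_def split: if_splits)
  next
    case (step n)
    then have "Suc n < m" by simp
    then have "degree G (\<alpha> (Suc n)) \<le> degree G (\<alpha> n)" using degree_clique_diff[of n] s[of n] by simp
    then show ?case using step.IH by simp
  qed
qed

end

section \<open>Degree sequences of the models\<close>

locale degree_sorted_model = swap_model +
  assumes room: "\<And>k. Suc k < m \<Longrightarrow> 0 \<le> slack c \<tau> k"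
begin

lemma degree_antimono: "i \<le> j \<Longrightarrow> j < m \<Longrightarrow> degree G (\<alpha> j) \<le> degree G (\<alpha> i)"
proof (induction j rule: dec_induct)
  case (step n)
  then show ?case using degree_clique_diff[of n] room[of n] by simp
qed simp

lemma degree_A_ge: "k < m \<Longrightarrow> m - 1 \<le> degree G (\<alpha> k)"
  using degree_clique_ge room by blast

lemma sorted_vertex_list:
  obtains vs where "distinct vs" "set vs = verts G" "sorted_wrt (\<ge>) (map (degree G) vs)"
    "m \<le> length vs" "\<And>k. k < m \<Longrightarrow> vs ! k = \<alpha> k" "set (drop m vs) = B"
proof -
  obtain bs where bs: "set bs = B" "distinct bs" using finite_distinct_list[OF fin(3)] by blast
  define ws where "ws = rev (sort_key (degree G) bs)"
  have ws: "set ws = B" "distinct ws" "sorted_wrt (\<ge>) (map (degree G) ws)"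
    using bs by (simp_all add: ws_def rev_map[symmetric] sorted_wrt_rev)
  let ?vs = "map \<alpha> [0..<m] @ ws"
  have "sorted_wrt (\<ge>) (map (degree G) (map \<alpha> [0..<m]))"
    by (auto simp: sorted_wrt_iff_nth_less intro!: degree_antimono)
  moreover have "degree G b \<le> degree G (\<alpha> k)" if "b \<in> B" "k < m" for b k
    using small[OF that(1)] degree_A_ge[OF that(2)] by simp
  ultimately have "sorted_wrt (\<ge>) (map (degree G) ?vs)"
    using ws by (auto simp: sorted_wrt_append)
  moreover have "distinct ?vs" using ws inj by (auto simp: distinct_map lessThan_atLeast0)
  moreover have "set ?vs = verts G" using ws sub by (auto simp: lessThan_atLeast0)
  moreover have "\<And>k. k < m \<Longrightarrow> ?vs ! k = \<alpha> k" by (simp add: nth_append)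
  ultimately show ?thesis using that[of ?vs] ws by simp
qed

lemma length_deg_seq: "length (deg_seq G) = m + (\<Sum>t<m. c t)"
proof -
  have "length (deg_seq G) = m + card B" unfolding length_deg_seq_verts using card_A sub fin by (metis card_Un_disjoint Diff_disjoint verts_split)
  also have "int (card B) = int (\<Sum>t<m. c t)" using sum_B[of "\<lambda>_. 1"] by simp
  then have "card B = (\<Sum>t<m. c t)" by linarith
  finally show ?thesis .
qed

text \<open>The data \<open>m\<close>, \<open>c\<close> and the bits \<open>\<tau> k \<noteq> 0\<close> can be read off the degree sequence. For \<open>Delta k\<close> the
clique contributes nothing, as each \<open>\<alpha> i\<close> has degree at least \<open>m - 1\<close>, and the deficits in \<open>B\<close> add up
to the number of \<open>u \<in> P\<close> with degree \<open>\<tau> k\<close>.\<close>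

lemma deg_seq_data:
  shows "m_index (deg_seq G) = m"
    and "\<And>t. t < m \<Longrightarrow> card {j. m \<le> j \<and> j < length (deg_seq G) \<and> deg_seq G ! j = t} = c t"
    and "\<And>k. k < m \<Longrightarrow> deg_seq G ! k = degree G (\<alpha> k)"
    and "\<And>k. k \<in> {1..m} \<Longrightarrow> Delta k (deg_seq G) = of_bool (\<tau> k \<noteq> 0)"
proof -
  obtain vs where vs: "distinct vs" "set vs = verts G" "sorted_wrt (\<ge>) (map (degree G) vs)"
    "m \<le> length vs" "\<And>k. k < m \<Longrightarrow> vs ! k = \<alpha> k" and B: "set (drop m vs) = B"
    using sorted_vertex_list by blast
  have d: "deg_seq G = map (degree G) vs" by (rule deg_seq_eqI) fact+
  have nthB: "vs ! j \<in> B" if "m \<le> j" "j < length vs" for j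
    using that unfolding B[symmetric] by (auto simp: in_set_conv_nth intro!: exI[of _ "j - m"])
  show nth: "\<And>k. k < m \<Longrightarrow> deg_seq G ! k = degree G (\<alpha> k)" using d vs by simp
  show "m_index (deg_seq G) = m" unfolding m_index_def
  proof (rule Max_eqI)
    show "m \<in> {i \<in> {1..length (deg_seq G)}. i - 1 \<le> nth_term (deg_seq G) i}"
      using nth[of "m - 1"] degree_A_ge[of "m - 1"] m_pos vs(4) d by (auto simp: nth_term_def)
    fix i assume i: "i \<in> {i \<in> {1..length (deg_seq G)}. i - 1 \<le> nth_term (deg_seq G) i}"
    show "i \<le> m"
    proof (rule ccontr)
      assume "\<not> i \<le> m"
      then have "m \<le> i - 1" "i - 1 < length vs" using i d by auto
      then have "degree G (vs ! (i - 1)) < m" using nthB small by blast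
      then show False using i d \<open>m \<le> i - 1\<close> \<open>i - 1 < length vs\<close> by (auto simp: nth_term_def)
    qed
  qed simp
  show "card {j. m \<le> j \<and> j < length (deg_seq G) \<and> deg_seq G ! j = t} = c t" if "t < m" for t
  proof -
    have "bij_betw ((!) vs) {j. m \<le> j \<and> j < length (deg_seq G) \<and> deg_seq G ! j = t} {u \<in> B. degree G u = t}"
    proof (rule bij_betwI')
      fix b assume "b \<in> {u \<in> B. degree G u = t}"
      then have "b \<in> set (drop m vs)" "degree G b = t" using B by auto
      then obtain i where "i < length vs - m" "b = vs ! (m + i)" by (auto simp: in_set_conv_nth)
      then show "\<exists>j\<in>{j. m \<le> j \<and> j < length (deg_seq G) \<and> deg_seq G ! j = t}. b = vs ! j"
        using \<open>degree G b = t\<close> d by (intro bexI[of _ "m + i"]) auto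
    next
      fix j assume "j \<in> {j. m \<le> j \<and> j < length (deg_seq G) \<and> deg_seq G ! j = t}"
      then have "m \<le> j" "j < length vs" "degree G (vs ! j) = t" using d by auto
      then show "vs ! j \<in> {u \<in> B. degree G u = t}" using nthB by blast
    qed (use vs(1) d in \<open>auto simp: nth_eq_iff_index_eq\<close>)
    from bij_betw_same_card[OF this] show ?thesis by (simp only: count[OF that])
  qed
  show "Delta k (deg_seq G) = of_bool (\<tau> k \<noteq> 0)" if k: "k \<in> {1..m}" for k
  proof -
    let ?T = "\<alpha> ` {..<k}"
    have kl: "k \<le> length vs" using k vs(4) by auto
    have T: "?T = set (take k vs)"
    proof -
      have "\<alpha> i = vs ! i" if "i \<in> {0..<k}" for i using that k by (intro vs(5)[symmetric]) auto
      then have "\<alpha> ` {0..<k} = (!) vs ` {0..<k}" by (rule image_cong[OF refl])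
      then show ?thesis using nth_image[OF kl] by (simp only: lessThan_atLeast0)
    qed
    have TA: "?T \<subseteq> A" using k by auto
    have cT: "card ?T = k" using k inj by (subst card_image) (auto intro: inj_on_subset)
    have full: "nbrs G ?T (\<alpha> i) = k - of_bool (i < k)" if i: "i < m" for i
    proof -
      have "{u \<in> ?T. {u, \<alpha> i} \<in> edges G} = ?T - {\<alpha> i}"
        using k i clique simple_graphD(3)[OF simple, of "\<alpha> i" "\<alpha> i"]
        by (auto simp: image_iff) (metis order.strict_trans2)
      moreover have "\<alpha> i \<in> ?T \<longleftrightarrow> i < k" using i k inj_onD[OF inj, of i] by fastforce
      ultimately show ?thesis by (simp add: nbrs_def cT)
    qed
    have zero1: "(\<Sum>v\<in>?T. int k - 1 - int (nbrs G ?T v)) = 0"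
      by (rule sum.neutral) (use full k in \<open>auto simp: of_nat_diff\<close>)
    have zero2: "(\<Sum>v\<in>A - ?T. int (min k (degree G v)) - int (nbrs G ?T v)) = 0"
    proof (rule sum.neutral, rule ballI)
      fix v assume "v \<in> A - ?T"
      then obtain i where i: "v = \<alpha> i" "i < m" "\<not> i < k" by auto
      then have "k \<le> degree G v" using degree_A_ge[of i] by simp
      then show "int (min k (degree G v)) - int (nbrs G ?T v) = 0" using full i by simp
    qed
    have VT: "verts G - ?T = (A - ?T) \<union> B" using TA sub by auto
    have "Delta k (deg_seq G) = (\<Sum>v\<in>verts G - ?T. int (min k (degree G v)) - int (nbrs G ?T v))"
      unfolding d Delta_eq_sum_defects[OF simple vs(1,2) kl T] zero1 by simp
    also have "\<dots> = (\<Sum>v\<in>B. int (min k (degree G v)) - int (nbrs G ?T v))"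
      unfolding VT by (subst sum.union_disjoint) (use fin zero2 in auto)
    also have "\<dots> = (\<Sum>v\<in>B. 1 * of_bool (v \<in> P \<and> \<tau> k = degree G v))"
      by (intro sum.cong) (use k in \<open>auto simp: nbrs_initial\<close>)
    also have "\<dots> = of_bool (\<tau> k \<noteq> 0)" using sum_special[of "\<lambda>_. 1"] by simp
    finally show ?thesis .
  qed
qed

lemma image_mset_degree:
  "image_mset (degree G) (mset_set (verts G)) =
     image_mset (\<lambda>k. degree G (\<alpha> k)) (mset_set {..<m}) + image_mset (degree G) (mset_set B)"
proof -
  have "mset_set (verts G) = mset_set A + mset_set B"
    by (subst verts_split, rule mset_set_Union) (use fin in auto)
  moreover have "mset_set A = image_mset \<alpha> (mset_set {..<m})" by (simp add: image_mset_mset_set inj)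
  ultimately show ?thesis by (simp add: multiset.map_comp comp_def)
qed

end

lemma deg_seq_determines_data:
  assumes "degree_sorted_model G m c \<tau> \<alpha> P" "degree_sorted_model H m' c' \<tau>' \<beta> Q"
    and eq: "deg_seq G = deg_seq H"
  shows "m = m'" "\<And>t. t < m \<Longrightarrow> c t = c' t" "\<And>k. \<tau> k = 0 \<longleftrightarrow> \<tau>' k = 0"
proof -
  interpret G: degree_sorted_model G m c \<tau> \<alpha> P by fact
  interpret H: degree_sorted_model H m' c' \<tau>' \<beta> Q by fact
  show m: "m = m'" using G.deg_seq_data(1) H.deg_seq_data(1) eq by simp
  show "c t = c' t" if "t < m" for t using G.deg_seq_data(2)[of t] H.deg_seq_data(2)[of t] eq m that by simp
  show "\<tau> k = 0 \<longleftrightarrow> \<tau>' k = 0" for k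
  proof (cases "k \<in> {1..m}")
    case True
    then have "of_bool (\<tau> k \<noteq> 0) = (of_bool (\<tau>' k \<noteq> 0) :: int)"
      using G.deg_seq_data(4)[of k] H.deg_seq_data(4)[of k] eq m by metis
    then show ?thesis by (auto simp: of_bool_def split: if_splits)
  next
    case False
    then have "k = 0 \<or> m \<le> k" by auto
    then have "\<tau> k = 0" "\<tau>' k = 0" using G.track H.track m unfolding swap_track_def by metis+
    then show ?thesis by simp
  qed
qed

lemma count_image_mset_set:
  assumes "finite S"
  shows "count (image_mset f (mset_set S)) y = card {x \<in> S. f x = y}"
proof -
  have "count (image_mset f (mset_set S)) y = (\<Sum>x\<in>f -` {y} \<inter> S. count (mset_set S) x)"
    using assms by (simp add: count_image_mset)
  also have "\<dots> = (\<Sum>x\<in>f -` {y} \<inter> S. 1)" using assms by (intro sum.cong) auto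
  also have "f -` {y} \<inter> S = {x \<in> S. f x = y}" by auto
  finally show ?thesis by simp
qed

lemma deg_seq_eq_of_data:
  assumes "degree_sorted_model G m c \<tau> \<alpha> P" "degree_sorted_model H m c' \<tau>' \<beta> Q"
    and c: "\<And>t. t < m \<Longrightarrow> c t = c' t" and bits: "\<And>k. \<tau> k = 0 \<longleftrightarrow> \<tau>' k = 0"
  shows "deg_seq G = deg_seq H"
proof -
  interpret G: degree_sorted_model G m c \<tau> \<alpha> P by fact
  interpret H: degree_sorted_model H m c' \<tau>' \<beta> Q by fact
  have "degree G (\<alpha> k) = degree H (\<beta> k)" if "k < m" for k
  proof -
    have "(\<Sum>t\<in>{k<..<m}. int (c t)) = (\<Sum>t\<in>{k<..<m}. int (c' t))" using c by (intro sum.cong) auto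
    then have "int (degree G (\<alpha> k)) = int (degree H (\<beta> k))"
      by (simp only: G.degree_clique[OF that] H.degree_clique[OF that] bits)
    then show ?thesis by simp
  qed
  then have 1: "image_mset (\<lambda>k. degree G (\<alpha> k)) (mset_set {..<m}) = image_mset (\<lambda>k. degree H (\<beta> k)) (mset_set {..<m})"
    by (intro image_mset_cong) auto
  have 2: "image_mset (degree G) (mset_set G.B) = image_mset (degree H) (mset_set H.B)"
  proof (rule multiset_eqI)
    fix t
    have "card {u \<in> G.B. degree G u = t} = card {u \<in> H.B. degree H u = t}"
    proof (cases "t < m")
      case True then show ?thesis by (simp only: G.count H.count c)
    next
      case False
      then have "{u \<in> G.B. degree G u = t} = {}" "{u \<in> H.B. degree H u = t} = {}" using G.small H.small by blast+
      then show ?thesis by (simp only: card.empty)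
    qed
    then show "count (image_mset (degree G) (mset_set G.B)) t = count (image_mset (degree H) (mset_set H.B)) t"
      by (simp only: count_image_mset_set[OF G.fin(3)] count_image_mset_set[OF H.fin(3)])
  qed
  show ?thesis unfolding deg_seq_def G.image_mset_degree H.image_mset_degree 1 2 ..
qed

section \<open>Models with the same data are isomorphic\<close>

lemma bij_betw_of_fibres:
  assumes "finite S" "finite T" and eq: "\<And>y. card {u \<in> S. f u = y} = card {u \<in> T. g u = y}"
  obtains h where "bij_betw h S T" "\<And>u. u \<in> S \<Longrightarrow> g (h u) = f u"
proof -
  have "\<exists>h. bij_betw h {u \<in> S. f u = y} {u \<in> T. g u = y}" for y
    by (rule finite_same_card_bij) (use assms in auto)
  then obtain h where h: "\<And>y. bij_betw (h y) {u \<in> S. f u = y} {u \<in> T. g u = y}" by metis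
  define H where "H u = h (f u) u" for u
  have H: "H u \<in> T" "g (H u) = f u" if "u \<in> S" for u
    using h[of "f u"] that unfolding H_def by (auto simp: bij_betw_def)
  have "inj_on H S"
  proof (rule inj_onI)
    fix u v assume uv: "u \<in> S" "v \<in> S" "H u = H v"
    then have "f u = f v" using H by metis
    then show "u = v" using h[of "f v"] uv by (auto simp: bij_betw_def inj_on_def H_def)
  qed
  moreover have "T \<subseteq> H ` S"
  proof
    fix v assume "v \<in> T"
    then have "v \<in> h (g v) ` {u \<in> S. f u = g v}" using h[of "g v"] by (auto simp: bij_betw_def)
    then obtain u where "u \<in> S" "f u = g v" "v = h (g v) u" by auto
    then have "v = H u" by (simp add: H_def)
    then show "v \<in> H ` S" using \<open>u \<in> S\<close> by blast
  qed
  ultimately have "bij_betw H S T" using H by (auto simp: bij_betw_def)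
  then show thesis using that H by blast
qed

text \<open>The data determine how many vertices of \<open>B\<close> have a given degree and a given status with respect
to \<open>P\<close>; the adjacency of a vertex of \<open>B\<close> to the clique depends on nothing else.\<close>

lemma (in swap_model) card_special_fibre:
  "card {u \<in> B. (degree G u, u \<in> P) = (t, b)} =
     (if b then of_bool (0 < t \<and> \<tau> t = t) else of_bool (t < m) * c t - of_bool (0 < t \<and> \<tau> t = t))"
proof -
  have P1: "card {u \<in> B. degree G u = t \<and> u \<in> P} = of_bool (0 < t \<and> \<tau> t = t)"
  proof (cases "0 < t \<and> \<tau> t = t")
    case True
    then have "t \<in> degree G ` P" using P_deg by simp
    then obtain p where p: "p \<in> P" "degree G p = t" by auto
    then have "{u \<in> B. degree G u = t \<and> u \<in> P} = {p}" using P_inj P_sub by (auto simp: inj_on_def)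
    then show ?thesis using True by simp
  next
    case False
    then have "t \<notin> degree G ` P" using P_deg by simp
    then have "{u \<in> B. degree G u = t \<and> u \<in> P} = {}" by auto
    then show ?thesis using False by (simp only: card.empty) simp
  qed
  have all: "card {u \<in> B. degree G u = t} = of_bool (t < m) * c t"
  proof (cases "t < m")
    case False
    then have "{u \<in> B. degree G u = t} = {}" using small by blast
    then show ?thesis using False by (simp only: card.empty) simp
  next
    case True
    then show ?thesis by (simp only: count) simp
  qed
  have "{u \<in> B. degree G u = t \<and> u \<notin> P} = {u \<in> B. degree G u = t} - {u \<in> B. degree G u = t \<and> u \<in> P}" by auto
  moreover have "card ({u \<in> B. degree G u = t} - {u \<in> B. degree G u = t \<and> u \<in> P}) =
      card {u \<in> B. degree G u = t} - card {u \<in> B. degree G u = t \<and> u \<in> P}"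
    by (rule card_Diff_subset) (use fin in auto)
  ultimately have P0: "card {u \<in> B. degree G u = t \<and> u \<notin> P} = of_bool (t < m) * c t - of_bool (0 < t \<and> \<tau> t = t)"
    by (simp only: all P1)
  show ?thesis
  proof (cases b)
    case True
    have "{u \<in> B. (degree G u, u \<in> P) = (t, b)} = {u \<in> B. degree G u = t \<and> u \<in> P}" using True by auto
    then show ?thesis using P1 True by simp
  next
    case False
    have "{u \<in> B. (degree G u, u \<in> P) = (t, b)} = {u \<in> B. degree G u = t \<and> u \<notin> P}" using False by auto
    then show ?thesis using P0 False by simp
  qed
qed

lemma graph_iso_of_data:
  assumes "swap_model G m c \<tau> \<alpha> P" "swap_model H m c' \<tau> \<beta> Q"
    and c: "\<And>t. t < m \<Longrightarrow> c t = c' t"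
  shows "graph_iso G H"
proof -
  interpret G: swap_model G m c \<tau> \<alpha> P by fact
  interpret H: swap_model H m c' \<tau> \<beta> Q by fact
  have "card {u \<in> G.B. (degree G u, u \<in> P) = y} = card {u \<in> H.B. (degree H u, u \<in> Q) = y}" for y
  proof -
    obtain t b where y: "y = (t, b)" by force
    have "of_bool (t < m) * c t = of_bool (t < m) * c' t" by (cases "t < m") (simp_all add: c)
    then show ?thesis unfolding y by (simp only: G.card_special_fibre H.card_special_fibre)
  qed
  then obtain h where h: "bij_betw h G.B H.B" and
    hP: "\<And>u. u \<in> G.B \<Longrightarrow> (degree H (h u), h u \<in> Q) = (degree G u, u \<in> P)"
    using bij_betw_of_fibres[OF G.fin(3) H.fin(3), of "\<lambda>u. (degree G u, u \<in> P)" "\<lambda>u. (degree H u, u \<in> Q)"] by blast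
  have hB: "u \<in> G.B \<Longrightarrow> h u \<in> H.B" for u using h by (auto simp: bij_betw_def)
  define \<phi> where "\<phi> v = (if v \<in> G.A then \<beta> (inv_into {..<m} \<alpha> v) else h v)" for v
  have \<phi>A: "\<phi> (\<alpha> k) = \<beta> k" if "k < m" for k using that G.inj by (auto simp: \<phi>_def)
  have \<phi>B: "\<phi> u = h u" if "u \<in> G.B" for u using that by (auto simp: \<phi>_def)
  have "bij_betw \<phi> G.A H.A"
  proof (rule bij_betwI')
    fix x y assume "x \<in> G.A" "y \<in> G.A"
    then obtain i j where "x = \<alpha> i" "y = \<alpha> j" "i < m" "j < m" by auto
    then show "\<phi> x = \<phi> y \<longleftrightarrow> x = y" using \<phi>A G.inj H.inj by (auto simp: inj_on_def)
  qed (auto simp: \<phi>A intro: bexI[of _ "\<alpha> _"])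
  moreover have "bij_betw \<phi> G.B H.B" using h \<phi>B by (subst bij_betw_cong[of _ _ h]) auto
  ultimately have "bij_betw \<phi> (G.A \<union> G.B) (H.A \<union> H.B)" by (rule bij_betw_combine) auto
  then have bij: "bij_betw \<phi> (verts G) (verts H)" using G.verts_split H.verts_split by simp
  have adjAB: "{\<alpha> k, u} \<in> edges G \<longleftrightarrow> {\<beta> k, h u} \<in> edges H" if "k < m" "u \<in> G.B" for k u
  proof -
    have "(of_bool ({\<alpha> k, u} \<in> edges G) :: int) = of_bool ({\<beta> k, h u} \<in> edges H)"
      using G.adj[OF that(2,1)] H.adj[OF hB[OF that(2)] that(1)] hP[OF that(2)] by simp
    then show ?thesis by (auto simp: of_bool_def split: if_splits)
  qed
  have "{u, v} \<in> edges G \<longleftrightarrow> {\<phi> u, \<phi> v} \<in> edges H" if uv: "u \<in> verts G" "v \<in> verts G" for u v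
  proof -
    consider (AA) i j where "i < m" "j < m" "u = \<alpha> i" "v = \<alpha> j" | (AB) i where "i < m" "u = \<alpha> i" "v \<in> G.B"
      | (BA) j where "j < m" "v = \<alpha> j" "u \<in> G.B" | (BB) "u \<in> G.B" "v \<in> G.B" using uv by blast
    then show ?thesis
    proof cases
      case AA
      then show ?thesis
        using G.clique[of i j] H.clique[of i j] simple_graphD(3)[OF G.simple, of u v] simple_graphD(3)[OF H.simple, of "\<beta> i" "\<beta> j"]
        by (cases "i = j") (auto simp: \<phi>A)
    next
      case (AB i) then show ?thesis using adjAB[of i v] by (simp add: \<phi>A \<phi>B)
    next
      case (BA j) then show ?thesis using adjAB[of j u] by (simp add: \<phi>A \<phi>B insert_commute)
    next
      case BB then show ?thesis using G.indep[OF BB] H.indep[OF hB[OF BB(1)] hB[OF BB(2)]] by (simp add: \<phi>B)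
    qed
  qed
  then show ?thesis using bij unfolding graph_iso_def by blast
qed

section \<open>Isomorphic canonical models have the same data\<close>

lemma neighbours_image_of_iso:
  assumes f: "bij_betw f (verts G) (verts H)"
    and e: "\<forall>u\<in>verts G. \<forall>v\<in>verts G. {u, v} \<in> edges G \<longleftrightarrow> {f u, f v} \<in> edges H"
    and v: "v \<in> verts G"
  shows "bij_betw f {u \<in> verts G. {u, v} \<in> edges G} {u \<in> verts H. {u, f v} \<in> edges H}"
proof (rule bij_betwI')
  fix y assume y: "y \<in> {u \<in> verts H. {u, f v} \<in> edges H}"
  then obtain x where "x \<in> verts G" "y = f x" using f by (auto simp: bij_betw_def)
  then show "\<exists>x\<in>{u \<in> verts G. {u, v} \<in> edges G}. y = f x" using y e v by auto
qed (use f e v in \<open>auto simp: bij_betw_def inj_on_eq_iff\<close>)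

lemma iso_preserves_degree_neighbour_degree_sum:
  assumes G: "simple_graph G" and H: "simple_graph H"
    and f: "bij_betw f (verts G) (verts H)"
    and e: "\<forall>u\<in>verts G. \<forall>v\<in>verts G. {u, v} \<in> edges G \<longleftrightarrow> {f u, f v} \<in> edges H"
    and v: "v \<in> verts G"
  shows "degree H (f v) = degree G v" "neighbour_degree_sum H (f v) = neighbour_degree_sum G v"
proof -
  note b = neighbours_image_of_iso[OF f e]
  have d: "degree H (f v) = degree G v" if "v \<in> verts G" for v
    using bij_betw_same_card[OF b[OF that]] by (simp add: degree_eq_nbrs[OF G] degree_eq_nbrs[OF H] nbrs_def)
  have "neighbour_degree_sum H (f v) = (\<Sum>u\<in>{u \<in> verts G. {u, v} \<in> edges G}. degree H (f u))"
    unfolding neighbour_degree_sum_def by (rule sum.reindex_bij_betw[OF b[OF v], symmetric])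
  also have "\<dots> = neighbour_degree_sum G v" unfolding neighbour_degree_sum_def by (rule sum.cong) (auto simp: d)
  finally show "neighbour_degree_sum H (f v) = neighbour_degree_sum G v" .
  show "degree H (f v) = degree G v" using d v .
qed

definition vkey :: "'a ugraph \<Rightarrow> 'a \<Rightarrow> nat \<times> nat" where
  "vkey G v = (degree G v, neighbour_degree_sum G v)"

lemma graph_iso_vkey_mset:
  assumes G: "simple_graph G" and H: "simple_graph H" and iso: "graph_iso G H"
  shows "image_mset (vkey G) (mset_set (verts G)) = image_mset (vkey H) (mset_set (verts H))"
proof -
  obtain f where f: "bij_betw f (verts G) (verts H)"
    and e: "\<forall>u\<in>verts G. \<forall>v\<in>verts G. {u, v} \<in> edges G \<longleftrightarrow> {f u, f v} \<in> edges H"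
    using iso by (auto simp: graph_iso_def)
  have "mset_set (verts H) = image_mset f (mset_set (verts G))"
    using f by (simp add: bij_betw_def image_mset_mset_set)
  then have "image_mset (vkey H) (mset_set (verts H)) = image_mset (\<lambda>v. vkey H (f v)) (mset_set (verts G))"
    by (simp add: multiset.map_comp comp_def)
  also have "\<dots> = image_mset (vkey G) (mset_set (verts G))"
    by (rule image_mset_cong) (use iso_preserves_degree_neighbour_degree_sum[OF G H f e] simple_graphD[OF G] in \<open>auto simp: vkey_def\<close>)
  finally show ?thesis by simp
qed

lemma graph_iso_deg_seq:
  assumes G: "simple_graph G" and H: "simple_graph H" and iso: "graph_iso G H"
  shows "deg_seq G = deg_seq H"
proof -
  have *: "image_mset (degree K) S = image_mset fst (image_mset (vkey K) S)" for K S
    by (simp add: multiset.map_comp comp_def vkey_def)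
  show ?thesis unfolding deg_seq_def * graph_iso_vkey_mset[OF assms] ..
qed

lemma graph_iso_refl: "graph_iso G G"
  unfolding graph_iso_def by (intro exI[of _ id]) auto

lemma graph_iso_sym:
  assumes "graph_iso G H"
  shows "graph_iso H G"
proof -
  obtain f where f: "bij_betw f (verts G) (verts H)"
    and e: "\<forall>u\<in>verts G. \<forall>v\<in>verts G. {u, v} \<in> edges G \<longleftrightarrow> {f u, f v} \<in> edges H"
    using assms by (auto simp: graph_iso_def)
  let ?g = "inv_into (verts G) f"
  have g: "bij_betw ?g (verts H) (verts G)" by (rule bij_betw_inv_into[OF f])
  have "?g u \<in> verts G" "f (?g u) = u" if "u \<in> verts H" for u
    using that f bij_betwE[OF g] bij_betw_inv_into_right[OF f] by auto
  then have "{u, v} \<in> edges H \<longleftrightarrow> {?g u, ?g v} \<in> edges G" if "u \<in> verts H" "v \<in> verts H" for u v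
    using e that by metis
  then show ?thesis using g unfolding graph_iso_def by blast
qed

lemma graph_iso_trans:
  assumes "graph_iso G H" "graph_iso H K"
  shows "graph_iso G K"
proof -
  obtain f where f: "bij_betw f (verts G) (verts H)"
    "\<forall>u\<in>verts G. \<forall>v\<in>verts G. {u, v} \<in> edges G \<longleftrightarrow> {f u, f v} \<in> edges H"
    using assms by (auto simp: graph_iso_def)
  obtain g where g: "bij_betw g (verts H) (verts K)"
    "\<forall>u\<in>verts H. \<forall>v\<in>verts H. {u, v} \<in> edges H \<longleftrightarrow> {g u, g v} \<in> edges K"
    using assms by (auto simp: graph_iso_def)
  have "bij_betw (g \<circ> f) (verts G) (verts K)" by (rule bij_betw_trans[OF f(1) g(1)])
  then show ?thesis using f g bij_betwE[OF f(1)] unfolding graph_iso_def by (intro exI[of _ "g \<circ> f"]) auto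
qed

text \<open>The listing of the clique is normalised: among vertices with the same degree, those with the
larger sum of neighbour degrees come first.\<close>

locale canonical_model = degree_sorted_model +
  assumes tie: "\<And>k. Suc k < m \<Longrightarrow> slack c \<tau> k = 0 \<Longrightarrow> 0 \<le> tie_slack c \<tau> k"
begin

lemma vkey_antimono: "i \<le> j \<Longrightarrow> j < m \<Longrightarrow> vkey G (\<alpha> j) \<le> vkey G (\<alpha> i)"
proof (induction j rule: dec_induct)
  case (step n)
  then have "Suc n < m" by simp
  then have "vkey G (\<alpha> (Suc n)) \<le> vkey G (\<alpha> n)"
    using degree_clique_diff[of n] neighbour_degree_sum_clique_diff[of n] room[of n] tie[of n]
    by (cases "slack c \<tau> n = 0") (auto simp: vkey_def less_eq_prod_simp)
  then show ?case using step by simp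
qed simp

text \<open>The only possible tie between a clique vertex and a vertex outside the clique is at
  degree \<open>m - 1\<close>, and then both have the same neighbours.\<close>

lemma vkey_B_le:
  assumes u: "u \<in> B"
  shows "vkey G u \<le> vkey G (\<alpha> (m - 1))"
proof (cases "degree G u < degree G (\<alpha> (m - 1))")
  case True
  then show ?thesis by (simp add: vkey_def less_eq_prod_simp)
next
  case False
  have m1: "m - 1 < m" using m_pos by simp
  have "\<tau> m = 0" using track by (simp add: swap_track_def)
  have dA: "degree G (\<alpha> (m - 1)) = m - 1 + of_bool (\<tau> (m - 1) \<noteq> 0)"
  proof -
    have "{m - 1<..<m} = {}" by auto
    then have "int (degree G (\<alpha> (m - 1))) = int m - 1 + of_bool (\<tau> (m - 1) \<noteq> 0)"
      using degree_clique[OF m1] \<open>\<tau> m = 0\<close> m_pos by simp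
    then show ?thesis using m_pos by (auto simp: of_bool_def split: if_splits)
  qed
  with False small[OF u] have du: "degree G u = m - 1" and t0: "\<tau> (m - 1) = 0"
    by (auto simp: of_bool_def split: if_splits)
  have notP: "u \<notin> P"
  proof
    assume "u \<in> P"
    then have "m - 1 \<in> degree G ` P" using du by force
    then show False using P_deg t0 by simp
  qed
  have nu: "{x \<in> verts G. {x, u} \<in> edges G} = \<alpha> ` {..<m - 1}"
  proof -
    have "{\<alpha> k, u} \<in> edges G \<longleftrightarrow> k < m - 1" if "k < m" for k
      using adj[OF u that] notP du by (auto simp: of_bool_def split: if_splits)
    then show ?thesis using sub indep[OF _ u] by force
  qed
  have "card {x \<in> verts G. {x, \<alpha> (m - 1)} \<in> edges G} = m - 1"
    using degree_eq_nbrs[OF simple, of "\<alpha> (m - 1)"] dA t0 by (simp add: nbrs_def)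
  moreover have "card (\<alpha> ` {..<m - 1}) = m - 1" using inj by (subst card_image) (auto intro: inj_on_subset)
  moreover have "\<alpha> ` {..<m - 1} \<subseteq> {x \<in> verts G. {x, \<alpha> (m - 1)} \<in> edges G}"
    using sub clique[of _ "m - 1"] m_pos by auto
  ultimately have "\<alpha> ` {..<m - 1} = {x \<in> verts G. {x, \<alpha> (m - 1)} \<in> edges G}"
    using fin(1) by (intro card_subset_eq) auto
  then have "neighbour_degree_sum G u = neighbour_degree_sum G (\<alpha> (m - 1))" unfolding neighbour_degree_sum_def nu by (simp only:)
  then show ?thesis using dA du t0 by (simp add: vkey_def)
qed

text \<open>Reads the keys of the clique vertices off the multiset of all keys: they are listed in decreasing order, and by
\<open>vkey_B_le\<close> no key of another vertex exceeds the last of them.\<close>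

lemma vkey_sorted_list:
  obtains ks where "mset ks = image_mset (vkey G) (mset_set (verts G))" "sorted_wrt (\<ge>) ks"
    "m \<le> length ks" "\<And>k. k < m \<Longrightarrow> ks ! k = vkey G (\<alpha> k)"
proof -
  obtain bs where bs: "set bs = B" "distinct bs" using finite_distinct_list[OF fin(3)] by blast
  define ws where "ws = rev (sort (map (vkey G) bs))"
  let ?ks = "map (\<lambda>k. vkey G (\<alpha> k)) [0..<m] @ ws"
  have "mset ws = image_mset (vkey G) (mset_set B)" using bs by (simp add: ws_def mset_set_set[symmetric])
  moreover have "image_mset (vkey G) (mset_set (verts G)) = image_mset (vkey G) (mset_set A) + image_mset (vkey G) (mset_set B)"
    by (subst verts_split, subst mset_set_Union) (use fin in auto)
  moreover have "mset (map (\<lambda>k. vkey G (\<alpha> k)) [0..<m]) = image_mset (vkey G) (mset_set A)"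
  proof -
    have "mset_set A = image_mset \<alpha> (mset_set {..<m})" by (simp add: image_mset_mset_set inj)
    then show ?thesis by (simp add: multiset.map_comp comp_def lessThan_atLeast0 mset_upt)
  qed
  ultimately have 1: "mset ?ks = image_mset (vkey G) (mset_set (verts G))" by simp
  have "sorted_wrt (\<ge>) ws" by (simp add: ws_def sorted_wrt_rev)
  moreover have "sorted_wrt (\<ge>) (map (\<lambda>k. vkey G (\<alpha> k)) [0..<m])"
    by (auto simp: sorted_wrt_iff_nth_less intro!: vkey_antimono)
  moreover have "w \<le> vkey G (\<alpha> k)" if "w \<in> set ws" "k < m" for w k
  proof -
    obtain b where "b \<in> B" "w = vkey G b" using \<open>w \<in> set ws\<close> bs by (auto simp: ws_def)
    then show ?thesis using vkey_B_le[of b] vkey_antimono[of k "m - 1"] that by fastforce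
  qed
  ultimately have 2: "sorted_wrt (\<ge>) ?ks" by (auto simp: sorted_wrt_append)
  show ?thesis by (rule that[OF 1 2]) (auto simp: nth_append)
qed

end

text \<open>The two sorted key lists agree, so the sums of the neighbour degrees of \<open>\<alpha> k\<close> and \<open>\<beta> k\<close> agree, and these
sums give the differences of consecutive values of \<open>\<tau>\<close> and \<open>\<tau>'\<close>, both of which start with \<open>0\<close>.\<close>

lemma graph_iso_determines_track:
  assumes "canonical_model G m c \<tau> \<alpha> P" "canonical_model H m' c' \<tau>' \<beta> Q"
    and iso: "graph_iso G H"
  shows "m = m'" "\<And>t. t < m \<Longrightarrow> c t = c' t" "\<tau> = \<tau>'"
proof -
  interpret G: canonical_model G m c \<tau> \<alpha> P by fact
  interpret H: canonical_model H m' c' \<tau>' \<beta> Q by fact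
  have d: "deg_seq G = deg_seq H" by (rule graph_iso_deg_seq[OF G.simple H.simple iso])
  note det = deg_seq_determines_data[OF G.degree_sorted_model_axioms H.degree_sorted_model_axioms d]
  show m: "m = m'" and c: "\<And>t. t < m \<Longrightarrow> c t = c' t" using det by blast+
  obtain ks where ks: "mset ks = image_mset (vkey G) (mset_set (verts G))" "sorted_wrt (\<ge>) ks"
    "\<And>k. k < m \<Longrightarrow> ks ! k = vkey G (\<alpha> k)" using G.vkey_sorted_list by metis
  obtain ls where ls: "mset ls = image_mset (vkey H) (mset_set (verts H))" "sorted_wrt (\<ge>) ls"
    "\<And>k. k < m' \<Longrightarrow> ls ! k = vkey H (\<beta> k)" using H.vkey_sorted_list by metis
  have "mset (rev ks) = mset (rev ls)" using ks ls graph_iso_vkey_mset[OF G.simple H.simple iso] by simp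
  moreover have "sorted (rev ks)" "sorted (rev ls)" using ks ls by (simp_all add: sorted_wrt_rev)
  ultimately have "rev ks = rev ls" by (metis properties_for_sort)
  then have "ks = ls" by simp
  then have key: "vkey G (\<alpha> k) = vkey H (\<beta> k)" if "k < m" for k using ks(3) ls(3) m that by metis
  have step: "int (\<tau> k) - int (\<tau> (Suc k)) = int (\<tau>' k) - int (\<tau>' (Suc k))" if "k < m" for k
  proof -
    have "(\<Sum>i<m. int (degree G (\<alpha> i))) = (\<Sum>i<m. int (degree H (\<beta> i)))"
      using key by (intro sum.cong) (auto simp: vkey_def)
    moreover have "(\<Sum>t\<in>{k<..<m}. int (c t * t)) = (\<Sum>t\<in>{k<..<m}. int (c' t * t))"
      using c by (intro sum.cong) auto
    moreover have "degree G (\<alpha> k) = degree H (\<beta> k)" "neighbour_degree_sum G (\<alpha> k) = neighbour_degree_sum H (\<beta> k)"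
      using key[OF that] by (auto simp: vkey_def)
    ultimately show ?thesis using G.neighbour_degree_sum_clique[OF that] H.neighbour_degree_sum_clique[of k] that m by simp
  qed
  have zero: "\<tau> 0 = 0" "\<tau>' 0 = 0" and large: "\<And>k. m \<le> k \<Longrightarrow> \<tau> k = 0" "\<And>k. m \<le> k \<Longrightarrow> \<tau>' k = 0"
    using G.track H.track m unfolding swap_track_def by metis+
  have "\<tau> k = \<tau>' k" if "k \<le> m" for k
    using that
  proof (induction k)
    case (Suc k)
    then show ?case using step[of k] by simp
  qed (simp add: zero)
  then show "\<tau> = \<tau>'" using large by (metis ext nle_le)
qed

section \<open>Extracting the data from a weakly threshold graph\<close>

text \<open>Here \<open>f u k\<close> stands for the deficit of \<open>u\<close> at \<open>k\<close>. It cannot decrease before \<open>k\<close> reaches the degree of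
\<open>u\<close> and cannot increase afterwards, so if it is ever \<open>1\<close> then it is \<open>1\<close> at the degree itself. Since the
deficits at one position add up to at most \<open>1\<close>, a vertex with a deficit is determined by its degree.\<close>

lemma swap_track_of_defects:
  fixes f :: "'b \<Rightarrow> nat \<Rightarrow> int"
  assumes fin: "finite B" and D: "\<And>u. u \<in> B \<Longrightarrow> D u < m"
    and ends: "\<And>u. u \<in> B \<Longrightarrow> f u 0 = 0" "\<And>u. u \<in> B \<Longrightarrow> f u m = 0"
    and nonneg: "\<And>u k. u \<in> B \<Longrightarrow> k \<le> m \<Longrightarrow> 0 \<le> f u k"
    and sum: "\<And>k. k \<le> m \<Longrightarrow> (\<Sum>u\<in>B. f u k) \<le> 1"
    and up: "\<And>u k. u \<in> B \<Longrightarrow> k < m \<Longrightarrow> k < D u \<Longrightarrow> f u k \<le> f u (Suc k)"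
    and down: "\<And>u k. u \<in> B \<Longrightarrow> k < m \<Longrightarrow> D u \<le> k \<Longrightarrow> f u (Suc k) \<le> f u k"
  obtains \<tau> P where "swap_track m \<tau>" "P \<subseteq> B" "inj_on D P" "D ` P = {t. 0 < t \<and> \<tau> t = t}"
    "\<And>u k. u \<in> B \<Longrightarrow> k \<le> m \<Longrightarrow> f u k = of_bool (u \<in> P \<and> \<tau> k = D u)"
proof -
  have f01: "f u k = 0 \<or> f u k = 1" if "u \<in> B" "k \<le> m" for u k
  proof -
    have "f u k \<le> (\<Sum>u\<in>B. f u k)" by (rule member_le_sum) (use that fin nonneg in auto)
    then show ?thesis using sum[OF that(2)] nonneg[OF that] by linarith
  qed
  have uniq: "u = v" if "u \<in> B" "v \<in> B" "k \<le> m" "f u k = 1" "f v k = 1" for u v k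
  proof (rule ccontr)
    assume "u \<noteq> v"
    have "(\<Sum>w\<in>{u, v}. f w k) \<le> (\<Sum>w\<in>B. f w k)" by (rule sum_mono2) (use that fin nonneg in auto)
    then show False using sum[OF that(3)] \<open>u \<noteq> v\<close> that by simp
  qed
  have pup: "f u l = 1" if "u \<in> B" "f u k = 1" "k \<le> l" "l \<le> D u" for u k l
    using that(3,4)
  proof (induction l rule: dec_induct)
    case (step n)
    then show ?case using up[of u n] f01[of u "Suc n"] D[of u] that by fastforce
  qed (use that in auto)
  have pdown: "f u l = 1" if "u \<in> B" "f u k = 1" "l \<le> k" "D u \<le> l" "k \<le> m" for u k l
    using that(3,4)
  proof (induction l rule: inc_induct)
    case (step n)
    then show ?case using down[of u n] f01[of u n] that by fastforce
  qed (use that in auto)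
  have pfix: "f u (D u) = 1" if "u \<in> B" "f u k = 1" "k \<le> m" for u k
    using pup[OF that(1,2), of "D u"] pdown[OF that(1,2), of "D u"] that(3) by (cases "k \<le> D u") auto
  have Dpos: "0 < D u" if "u \<in> B" "f u k = 1" "k \<le> m" for u k
    using pfix[OF that] ends(1)[OF that(1)] by (cases "D u") auto
  define \<tau> where "\<tau> k = (if k \<le> m \<and> (\<exists>u\<in>B. f u k = 1) then D (SOME u. u \<in> B \<and> f u k = 1) else 0)" for k
  have \<tau>I: "\<tau> k = D u" if "u \<in> B" "f u k = 1" "k \<le> m" for u k
  proof -
    have "(SOME u. u \<in> B \<and> f u k = 1) = u" by (rule some_equality) (use that uniq in auto)
    then show ?thesis using that by (auto simp: \<tau>_def)
  qed
  have \<tau>E: "\<exists>u\<in>B. k \<le> m \<and> f u k = 1 \<and> \<tau> k = D u" if "\<tau> k \<noteq> 0" for k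
    using that \<tau>I by (fastforce simp: \<tau>_def split: if_splits)
  define P where "P = {u \<in> B. \<exists>k\<le>m. f u k = 1}"
  have same: "u = v" if "u \<in> P" "v \<in> P" "D u = D v" for u v
  proof -
    have "f u (D u) = 1" "f v (D v) = 1" "u \<in> B" "v \<in> B"
      using that(1,2) pfix unfolding P_def by blast+
    then show ?thesis using uniq[of u v "D u"] D[of u] that(3) by simp
  qed
  show ?thesis
  proof (rule that[of \<tau> P])
    show "swap_track m \<tau>" unfolding swap_track_def
    proof (intro conjI allI impI)
      show "\<tau> 0 = 0" using \<tau>E[of 0] ends by fastforce
      show "\<tau> k = 0" if "m \<le> k" for k using \<tau>E[of k] ends that by fastforce
      show "\<tau> (Suc k) = \<tau> k" if k: "k < \<tau> k" for k
      proof -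
        obtain u where u: "u \<in> B" "f u k = 1" "\<tau> k = D u" using \<tau>E[of k] k by auto
        then have "f u (Suc k) = 1" using pup[of u k "Suc k"] k by simp
        then show ?thesis using \<tau>I[of u "Suc k"] u k D[of u] by simp
      qed
      show "\<tau> k = \<tau> (Suc k)" if k: "0 < \<tau> (Suc k) \<and> \<tau> (Suc k) < Suc k" for k
      proof -
        obtain u where u: "u \<in> B" "f u (Suc k) = 1" "\<tau> (Suc k) = D u" "Suc k \<le> m" using \<tau>E[of "Suc k"] k by auto
        then have "f u k = 1" using pdown[of u "Suc k" k] k by simp
        then show ?thesis using \<tau>I[of u k] u by simp
      qed
    qed
    show "P \<subseteq> B" by (auto simp: P_def)
    show "inj_on D P" using same by (auto simp: inj_on_def)
    show "D ` P = {t. 0 < t \<and> \<tau> t = t}"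
    proof safe
      fix u assume "u \<in> P"
      then obtain k where u: "u \<in> B" "k \<le> m" "f u k = 1" by (auto simp: P_def)
      then show "0 < D u" using Dpos by blast
      show "\<tau> (D u) = D u" using \<tau>I[of u "D u"] pfix[OF u(1,3,2)] D[OF u(1)] u(1) by simp
    next
      fix t assume "0 < t" "\<tau> t = t"
      then obtain u where u: "u \<in> B" "t \<le> m" "f u t = 1" "\<tau> t = D u" using \<tau>E[of t] by auto
      then have "u \<in> P" "t = D u" using \<open>\<tau> t = t\<close> by (auto simp: P_def)
      then show "t \<in> D ` P" by blast
    qed
    show "f u k = of_bool (u \<in> P \<and> \<tau> k = D u)" if u: "u \<in> B" and k: "k \<le> m" for u k
    proof (cases "f u k = 1")
      case True
      then have "u \<in> P" using u k by (auto simp: P_def)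
      then show ?thesis using True \<tau>I[OF u True k] by simp
    next
      case False
      have "\<not> (u \<in> P \<and> \<tau> k = D u)"
      proof
        assume uP: "u \<in> P \<and> \<tau> k = D u"
        then have "\<tau> k \<noteq> 0" using Dpos by (auto simp: P_def)
        then obtain v where v: "v \<in> B" "f v k = 1" "\<tau> k = D v" using \<tau>E by blast
        then have "v \<in> P" using k by (auto simp: P_def)
        then have "u = v" using same uP v by metis
        then show False using False v by simp
      qed
      then show ?thesis using f01[OF u k] False by simp
    qed
  qed
qed

lemma all_zero_of_even_sum_le_1:
  fixes f g :: "'b \<Rightarrow> int"
  assumes "finite S" "finite T" "\<And>x. x \<in> S \<Longrightarrow> 0 \<le> f x" "\<And>x. x \<in> T \<Longrightarrow> 0 \<le> g x"
    and "even (sum f S + sum g T)" "sum f S + sum g T \<le> 1"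
  shows "\<And>x. x \<in> S \<Longrightarrow> f x = 0" "\<And>x. x \<in> T \<Longrightarrow> g x = 0"
proof -
  have "0 \<le> sum f S" "0 \<le> sum g T" using assms by (auto intro: sum_nonneg)
  moreover have "sum f S + sum g T \<noteq> 1" using assms(5) by (metis odd_one)
  ultimately have "sum f S = 0" "sum g T = 0" using assms(6) by linarith+
  then show "\<And>x. x \<in> S \<Longrightarrow> f x = 0" "\<And>x. x \<in> T \<Longrightarrow> g x = 0"
    using assms by (auto simp: sum_nonneg_eq_0_iff)
qed

text \<open>List the vertices by decreasing degree and, among equal degrees, by decreasing sum of neighbour
degrees. That a vertex after position \<open>m\<close> has degree less than \<open>m\<close> follows from the maximality
of \<open>m = m_index (deg_seq G)\<close>.\<close>

theorem weakly_threshold_graph_model: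
  assumes wt: "weakly_threshold_graph G"
  obtains m c \<tau> \<alpha> P where "canonical_model G m c \<tau> \<alpha> P"
proof -
  have G: "simple_graph G" and D1: "\<And>k. k \<in> {1..m_index (deg_seq G)} \<Longrightarrow> Delta k (deg_seq G) \<le> 1"
    using wt by (auto simp: weakly_threshold_graph_def weakly_threshold_seq_def)
  note gr = simple_graphD[OF G]
  obtain bs where bs: "set bs = verts G" "distinct bs" using finite_distinct_list[OF gr(1)] by blast
  define vs where "vs = rev (sort_key (vkey G) bs)"
  have vs: "distinct vs" "set vs = verts G" using bs by (auto simp: vs_def)
  have "sorted_wrt (\<ge>) (map (vkey G) vs)" by (simp add: vs_def rev_map[symmetric] sorted_wrt_rev)
  then have keys: "vkey G (vs ! j) \<le> vkey G (vs ! i)" if "i \<le> j" "j < length vs" for i j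
    using that by (cases "i = j") (auto simp: sorted_wrt_iff_nth_less)
  then have degs: "degree G (vs ! j) \<le> degree G (vs ! i)" if "i \<le> j" "j < length vs" for i j
    using that by (fastforce simp: vkey_def less_eq_prod_simp)
  then have "sorted_wrt (\<ge>) (map (degree G) vs)" by (auto simp: sorted_wrt_iff_nth_less)
  then have d: "deg_seq G = map (degree G) vs" using vs by (intro deg_seq_eqI)
  have n: "0 < length vs" using gr(2) vs by auto
  define M where "M = {i \<in> {1..length (deg_seq G)}. i - 1 \<le> nth_term (deg_seq G) i}"
  define m where "m = Max M"
  have M: "finite M" "1 \<in> M" using n by (auto simp: M_def d Suc_le_eq)
  have "m \<in> M" unfolding m_def by (rule Max_in) (use M in auto)
  then have m: "1 \<le> m" "m \<le> length vs" and dm: "m - 1 \<le> degree G (vs ! (m - 1))"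
    by (auto simp: M_def d nth_term_def)
  have m_idx: "m_index (deg_seq G) = m" by (simp add: m_index_def m_def M_def)
  define \<alpha> where "\<alpha> = (!) vs"
  have inj: "inj_on \<alpha> {..<m}" using vs(1) m by (auto simp: inj_on_def \<alpha>_def nth_eq_iff_index_eq)
  have sub: "\<alpha> ` {..<m} \<subseteq> verts G" unfolding vs(2)[symmetric] using m by (auto simp: \<alpha>_def)
  define B where "B = verts G - \<alpha> ` {..<m}"
  have fB: "finite B" using gr by (simp add: B_def)
  have degA: "m - 1 \<le> degree G (\<alpha> k)" if "k < m" for k
    using order_trans[OF dm degs[of k "m - 1"]] that m by (simp add: \<alpha>_def)
  have degB: "degree G u < m" if "u \<in> B" for u
  proof (rule ccontr)
    assume "\<not> degree G u < m"
    have "u \<in> set vs" using \<open>u \<in> B\<close> by (simp add: B_def vs(2))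
    then obtain j where j: "u = vs ! j" "j < length vs" unfolding in_set_conv_nth by blast
    then have "m \<le> j" using \<open>u \<in> B\<close> by (auto simp: B_def \<alpha>_def)
    then have "m \<le> degree G (vs ! m)" using degs[of m j] j \<open>\<not> degree G u < m\<close> by simp
    then have "Suc m \<in> M" using \<open>m \<le> j\<close> j by (auto simp: M_def d nth_term_def)
    then have "Suc m \<le> m" unfolding m_def using M by (intro Max_ge)
    then show False by simp
  qed
  define T where "T k = \<alpha> ` {..<k}" for k
  have cT: "card (T k) = k" if "k \<le> m" for k
    unfolding T_def using inj that by (subst card_image) (auto intro: inj_on_subset)
  have fT: "finite (T k)" for k by (simp add: T_def)
  have Delta: "Delta k (deg_seq G) = (\<Sum>v\<in>T k. int k - 1 - int (nbrs G (T k) v)) +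
      (\<Sum>v\<in>verts G - T k. int (min k (degree G v)) - int (nbrs G (T k) v))" if "k \<le> m" for k
  proof -
    have "T k = set (take k vs)"
      using nth_image[of k vs] that m by (simp add: T_def \<alpha>_def lessThan_atLeast0)
    then show ?thesis unfolding d using vs that m by (intro Delta_eq_sum_defects[OF G]) auto
  qed
  have degB_split: "degree G u = nbrs G (T m) u + nbrs G B u" for u
  proof -
    have "verts G = T m \<union> B" using sub by (auto simp: B_def T_def)
    then show ?thesis unfolding degree_eq_nbrs[OF G]
      by (simp only:) (rule nbrs_Un_disjoint, use fT fB in \<open>auto simp: B_def T_def\<close>)
  qed
  have self: "int (nbrs G (T k) v) \<le> int k - 1" if "v \<in> T k" "k \<le> m" for k v
  proof -
    have "k \<noteq> 0" using that(1) by (cases k) (auto simp: T_def)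
    then show ?thesis using nbrs_self_bound[OF G fT that(1)] cT[OF that(2)] by simp
  qed
  let ?defect = "(\<Sum>v\<in>T m. int m - 1 - int (nbrs G (T m) v)) + (\<Sum>u\<in>B. int (nbrs G B u))"
  have "(\<Sum>v\<in>verts G - T m. int (min m (degree G v)) - int (nbrs G (T m) v)) = (\<Sum>u\<in>B. int (nbrs G B u))"
  proof (rule sum.cong)
    fix u assume "u \<in> B"
    then show "int (min m (degree G u)) - int (nbrs G (T m) u) = int (nbrs G B u)"
      using degB[of u] degB_split[of u] by simp
  qed (simp add: B_def T_def)
  then have "Delta m (deg_seq G) = ?defect" using Delta[of m] by simp
  moreover have "Delta m (deg_seq G) \<le> 1" using D1 m m_idx by simp
  ultimately have le: "?defect \<le> 1" by simp
  have even: "even ?defect"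
    using even_sum_nbrs[OF G fT[of m]] even_sum_nbrs[OF G fB] by (simp add: sum_subtractf cT)
  have nonnegA: "0 \<le> int m - 1 - int (nbrs G (T m) v)" if "v \<in> T m" for v using self[OF that] by simp
  have nonnegB: "0 \<le> int (nbrs G B u)" for u by simp
  note zero = all_zero_of_even_sum_le_1[OF fT[of m] fB nonnegA nonnegB even le]
  have zA: "int m - 1 - int (nbrs G (T m) v) = 0" if "v \<in> T m" for v using zero(1) that by blast
  have zB: "int (nbrs G B u) = 0" if "u \<in> B" for u using zero(2) that by blast
  have clique: "{\<alpha> i, \<alpha> j} \<in> edges G" if ij: "i < m" "j < m" "i \<noteq> j" for i j
  proof -
    have j: "\<alpha> j \<in> T m" using ij by (simp add: T_def)
    have "{u \<in> T m. {u, \<alpha> j} \<in> edges G} = T m - {\<alpha> j}"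
    proof (rule card_subset_eq)
      show "{u \<in> T m. {u, \<alpha> j} \<in> edges G} \<subseteq> T m - {\<alpha> j}" using gr(3)[of "\<alpha> j" "\<alpha> j"] by auto
      show "card {u \<in> T m. {u, \<alpha> j} \<in> edges G} = card (T m - {\<alpha> j})"
        using zA[OF j] j cT[of m] fT[of m] m by (simp add: nbrs_def)
    qed (simp add: fT)
    moreover have "\<alpha> i \<in> T m - {\<alpha> j}" using ij inj by (auto simp: T_def inj_on_def)
    ultimately show ?thesis by blast
  qed
  have indep: "{u, v} \<notin> edges G" if "u \<in> B" "v \<in> B" for u v
    using zB[OF that(2)] that(1) fB by (auto simp: nbrs_def)
  define f where "f u k = int (min k (degree G u)) - int (nbrs G (T k) u)" for u k
  have f_step: "f u (Suc k) = f u k + of_bool (k < degree G u) - of_bool ({\<alpha> k, u} \<in> edges G)" if "k < m" for u k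
  proof -
    have "\<alpha> k \<notin> T k" using inj_onD[OF inj, of k] that by (fastforce simp: T_def)
    then have "int (nbrs G (T (Suc k)) u) = int (nbrs G (T k) u) + of_bool ({\<alpha> k, u} \<in> edges G)"
      by (simp add: int_nbrs T_def lessThan_Suc)
    then show ?thesis by (auto simp: f_def)
  qed
  have f_nonneg: "0 \<le> f u k" if "k \<le> m" for u k
  proof -
    have "nbrs G (T k) u \<le> degree G u" unfolding degree_eq_nbrs[OF G]
    proof (rule nbrs_mono[OF gr(1)])
      have "T k \<subseteq> \<alpha> ` {..<m}" using that by (auto simp: T_def)
      then show "T k \<subseteq> verts G" using sub by blast
    qed
    moreover have "nbrs G (T k) u \<le> k" using nbrs_le_card[OF fT, of G k u] cT[OF that] by simp
    ultimately show ?thesis by (simp add: f_def)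
  qed
  have f_sum: "(\<Sum>u\<in>B. f u k) \<le> 1" if k: "k \<le> m" for k
  proof (cases "k = 0")
    case True
    then show ?thesis by (simp add: f_def T_def nbrs_def)
  next
    case False
    have V: "verts G - T k = (T m - T k) \<union> B"
    proof -
      have "T k \<subseteq> T m" using k by (auto simp: T_def)
      then show ?thesis using sub by (auto simp: B_def T_def)
    qed
    have "(\<Sum>v\<in>verts G - T k. int (min k (degree G v)) - int (nbrs G (T k) v)) =
        (\<Sum>v\<in>T m - T k. f v k) + (\<Sum>v\<in>B. f v k)"
      unfolding V f_def by (rule sum.union_disjoint) (use fT fB in \<open>auto simp: B_def T_def\<close>)
    moreover have "0 \<le> (\<Sum>v\<in>T m - T k. f v k)" using f_nonneg k by (intro sum_nonneg) auto
    moreover have "0 \<le> (\<Sum>v\<in>T k. int k - 1 - int (nbrs G (T k) v))" by (rule sum_nonneg) (use self k in auto)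
    moreover have "Delta k (deg_seq G) \<le> 1" using D1 m_idx False k by simp
    ultimately show ?thesis using Delta[OF k] by linarith
  qed
  obtain \<tau> P where tr: "swap_track m \<tau>" and P: "P \<subseteq> B" "inj_on (degree G) P" "degree G ` P = {t. 0 < t \<and> \<tau> t = t}"
    and f_eq: "\<And>u k. u \<in> B \<Longrightarrow> k \<le> m \<Longrightarrow> f u k = of_bool (u \<in> P \<and> \<tau> k = degree G u)"
  proof (rule swap_track_of_defects[OF fB, of "degree G" m f])
    fix u assume u: "u \<in> B"
    show "degree G u < m" by (rule degB[OF u])
    show "f u 0 = 0" by (simp add: f_def T_def nbrs_def)
    show "f u m = 0" using degB[OF u] zB[OF u] degB_split[of u] by (simp add: f_def)
    fix k
    show "f u k \<le> f u (Suc k)" if "k < m" "k < degree G u" using f_step[OF that(1), of u] that by simp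
    show "f u (Suc k) \<le> f u k" if "k < m" "degree G u \<le> k" using f_step[OF that(1), of u] that by simp
  qed (use f_nonneg f_sum in auto)
  define c where "c t = card {u \<in> B. degree G u = t}" for t
  interpret swap_model G m c \<tau> \<alpha> P
  proof
    show "of_bool ({\<alpha> k, u} \<in> edges G) = of_bool (k < degree G u) + of_bool (u \<in> P \<and> \<tau> k = degree G u)
        - (of_bool (u \<in> P \<and> \<tau> (Suc k) = degree G u) :: int)" if "u \<in> verts G - \<alpha> ` {..<m}" "k < m" for u k
      using f_step[OF that(2), of u] f_eq[of u k] f_eq[of u "Suc k"] that by (simp add: B_def)
  qed (use G m tr inj sub clique indep degB P in \<open>auto simp: B_def c_def\<close>)
  have "canonical_model G m c \<tau> \<alpha> P"
  proof
    fix k assume k: "Suc k < m"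
    have k': "Suc k < length vs" using k m by simp
    show "0 \<le> slack c \<tau> k"
      using degree_clique_diff[OF k] degs[of k "Suc k"] k' by (simp add: \<alpha>_def)
    assume "slack c \<tau> k = 0"
    then have "degree G (vs ! k) = degree G (vs ! Suc k)" using degree_clique_diff[OF k] by (simp add: \<alpha>_def)
    then have "neighbour_degree_sum G (vs ! Suc k) \<le> neighbour_degree_sum G (vs ! k)"
      using keys[of k "Suc k"] k' by (simp add: vkey_def less_eq_prod_simp)
    then show "0 \<le> tie_slack c \<tau> k"
      using neighbour_degree_sum_clique_diff[OF k] \<open>slack c \<tau> k = 0\<close> by (simp add: \<alpha>_def)
  qed
  then show thesis by (rule that)
qed

section \<open>Constructing a graph from the data\<close>

text \<open>The vertices are \<open>a k\<close> for the clique and \<open>b t s\<close> with \<open>s < c t\<close>, the \<open>s\<close>-th vertex of degree \<open>t\<close>; if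
some vertex of degree \<open>t\<close> has to trade, it is \<open>b t 0\<close>. That \<open>b t s\<close> has degree \<open>t\<close> comes from
telescoping, because \<open>\<tau>\<close> vanishes at both ends.\<close>

theorem degree_sorted_model_exists:
  assumes m: "0 < m" and tr: "swap_track m \<tau>" and c: "\<And>t. 0 < t \<Longrightarrow> \<tau> t = t \<Longrightarrow> 0 < c t"
    and room: "\<And>k. Suc k < m \<Longrightarrow> 0 \<le> slack c \<tau> k"
  obtains G :: "nat ugraph" and \<alpha> P where "degree_sorted_model G m c \<tau> \<alpha> P"
proof -
  define a b where "a k = prod_encode (k, 0)" and "b t s = prod_encode (t, Suc s)" for k t s :: nat
  have ab: "a k = a k' \<longleftrightarrow> k = k'" "b t s = b t' s' \<longleftrightarrow> t = t' \<and> s = s'" "a k \<noteq> b t s" "b t s \<noteq> a k" for k k' t t' s s'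
    by (auto simp: a_def b_def)
  define sp where "sp t s \<longleftrightarrow> s = 0 \<and> 0 < t \<and> \<tau> t = t" for t s :: nat
  define val :: "nat \<Rightarrow> nat \<Rightarrow> nat \<Rightarrow> int" where
    "val k t s = of_bool (k < t) + of_bool (sp t s \<and> \<tau> k = t) - of_bool (sp t s \<and> \<tau> (Suc k) = t)" for k t s
  define E where "E = {{a i, a j} | i j. i < m \<and> j < m \<and> i \<noteq> j} \<union>
    {{a k, b t s} | k t s. k < m \<and> t < m \<and> s < c t \<and> val k t s = 1}"
  define V where "V = a ` {..<m} \<union> (\<lambda>(t, s). b t s) ` (SIGMA t:{..<m}. {..<c t})"
  define G where "G = (V, E)"
  have val01: "val k t s = 0 \<or> val k t s = 1" for k t s
  proof -
    have "\<tau> (Suc k) = t" if "sp t s" "k < t" "\<tau> k = t"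
      using tr that unfolding swap_track_def by metis
    moreover have "\<tau> k = t" if "sp t s" "\<not> k < t" "\<tau> (Suc k) = t"
    proof -
      have "0 < \<tau> (Suc k)" "\<tau> (Suc k) < Suc k" using that by (auto simp: sp_def)
      then show ?thesis using tr that unfolding swap_track_def by metis
    qed
    ultimately show ?thesis unfolding val_def by (auto simp: of_bool_def)
  qed
  have E_aa: "{a i, a j} \<in> E \<longleftrightarrow> i < m \<and> j < m \<and> i \<noteq> j" for i j
    by (auto simp: E_def doubleton_eq_iff ab)
  have E_ab: "{a k, b t s} \<in> E \<longleftrightarrow> k < m \<and> t < m \<and> s < c t \<and> val k t s = 1" for k t s
    by (auto simp: E_def doubleton_eq_iff ab)
  have E_bb: "{b t s, b t' s'} \<notin> E" for t s t' s'
    by (auto simp: E_def doubleton_eq_iff ab)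
  have sg: "simple_graph G" unfolding simple_graph_def
  proof (intro conjI ballI)
    show "finite (verts G)" by (simp add: G_def V_def)
    show "verts G \<noteq> {}" using m by (auto simp: G_def V_def)
    fix e assume "e \<in> edges G"
    then show "e \<subseteq> verts G" "card e = 2" by (auto simp: G_def E_def V_def ab card_insert_if)
  qed
  have B: "verts G - a ` {..<m} = (\<lambda>(t, s). b t s) ` (SIGMA t:{..<m}. {..<c t})"
    by (auto simp: G_def V_def ab)
  have bB: "\<exists>t s. u = b t s \<and> t < m \<and> s < c t" if "u \<in> verts G - a ` {..<m}" for u
    using that unfolding B by auto
  have \<tau>0: "\<tau> 0 = 0" and \<tau>m: "\<And>k. m \<le> k \<Longrightarrow> \<tau> k = 0" using tr unfolding swap_track_def by metis+
  have deg: "degree G (b t s) = t" if "t < m" "s < c t" for t s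
  proof -
    have "{u \<in> verts G. {u, b t s} \<in> edges G} = {u \<in> a ` {..<m}. {u, b t s} \<in> edges G}"
      by (auto simp: G_def V_def E_bb)
    then have "degree G (b t s) = nbrs G (a ` {..<m}) (b t s)" unfolding degree_eq_nbrs[OF sg] nbrs_def by simp
    also have "int \<dots> = (\<Sum>k<m. of_bool ({a k, b t s} \<in> edges G))"
      unfolding int_nbrs[OF finite_imageI[OF finite_lessThan]] by (subst sum.reindex) (auto simp: inj_on_def ab)
    also have "\<dots> = (\<Sum>k<m. val k t s)"
      by (rule sum.cong) (use that val01 in \<open>auto simp: G_def E_ab\<close>)
    also have "\<dots> = (\<Sum>k<m. of_bool (k < t)) + (\<Sum>k<m. of_bool (sp t s \<and> \<tau> k = t) - of_bool (sp t s \<and> \<tau> (Suc k) = t))"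
      by (simp add: val_def sum.distrib sum_subtractf)
    also have "(\<Sum>k<m. of_bool (sp t s \<and> \<tau> k = t) - of_bool (sp t s \<and> \<tau> (Suc k) = t)) =
        (of_bool (sp t s \<and> \<tau> 0 = t) - of_bool (sp t s \<and> \<tau> m = t) :: int)"
      by (rule sum_lessThan_telescope')
    also have "\<dots> = 0" using \<tau>0 \<tau>m[of m] by (auto simp: sp_def)
    also have "(\<Sum>k<m. of_bool (k < t)) = int t"
    proof -
      have "{..<m} \<inter> {k. k < t} = {..<t}" using that by auto
      then show ?thesis by (simp add: of_bool_def sum.If_cases)
    qed
    finally show ?thesis by simp
  qed
  define P where "P = (\<lambda>t. b t 0) ` {t. 0 < t \<and> \<tau> t = t}"
  have lt: "t < m" if "0 < t" "\<tau> t = t" for t using \<tau>m[of t] that by (cases "m \<le> t") auto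
  have bP: "b t s \<in> P \<longleftrightarrow> sp t s" for t s by (auto simp: P_def sp_def ab)
  have degP: "degree G (b t 0) = t" if "0 < t" "\<tau> t = t" for t using deg c lt that by simp
  have "degree_sorted_model G m c \<tau> a P"
  proof
    show "inj_on a {..<m}" by (auto simp: inj_on_def ab)
    show "a ` {..<m} \<subseteq> verts G" by (auto simp: G_def V_def)
    show "{a i, a j} \<in> edges G" if "i < m" "j < m" "i \<noteq> j" for i j using that by (simp add: G_def E_aa)
    show "{u, v} \<notin> edges G" if "u \<in> verts G - a ` {..<m}" "v \<in> verts G - a ` {..<m}" for u v
      using bB[OF that(1)] bB[OF that(2)] E_bb by (auto simp: G_def)
    show "degree G u < m" if "u \<in> verts G - a ` {..<m}" for u using bB[OF that] deg by auto
    show "card {u \<in> verts G - a ` {..<m}. degree G u = t} = c t" if "t < m" for t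
    proof -
      have "{u \<in> verts G - a ` {..<m}. degree G u = t} = b t ` {..<c t}"
        using that deg by (auto simp: B)
      then show ?thesis by (simp add: card_image inj_on_def ab)
    qed
    show "P \<subseteq> verts G - a ` {..<m}" unfolding P_def B using lt c by force
    show "inj_on (degree G) P" by (auto simp: P_def inj_on_def degP)
    show "degree G ` P = {t. 0 < t \<and> \<tau> t = t}" by (force simp: P_def degP)
    show "of_bool ({a k, u} \<in> edges G) = of_bool (k < degree G u) + of_bool (u \<in> P \<and> \<tau> k = degree G u)
        - (of_bool (u \<in> P \<and> \<tau> (Suc k) = degree G u) :: int)" if u: "u \<in> verts G - a ` {..<m}" and k: "k < m" for u k
    proof -
      obtain t s where u: "u = b t s" "t < m" "s < c t" using bB[OF u] by blast
      have "(of_bool ({a k, u} \<in> edges G) :: int) = val k t s"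
        using u k val01[of k t s] by (auto simp: G_def E_ab)
      then show ?thesis using u by (simp add: deg bP val_def)
    qed
  qed (use sg m tr room in auto)
  then show thesis by (rule that)
qed

lemma degree_sorted_model_weakly_threshold:
  fixes G :: "nat ugraph"
  assumes "degree_sorted_model G m c \<tau> \<alpha> P"
  shows "weakly_threshold_graph G"
proof -
  interpret degree_sorted_model G m c \<tau> \<alpha> P by fact
  show ?thesis
    unfolding weakly_threshold_graph_def weakly_threshold_seq_def degree_sequence_def
    using simple by (intro conjI exI[of _ G]) (auto simp: deg_seq_data)
qed

section \<open>Generating functions of words with bounds on three consecutive letters\<close>

text \<open>A word lists \<open>c t\<close> together with a letter for each \<open>t < m\<close>. Its weight \<open>m + c 0 + \<dots> + c (m - 1)\<close> is the
number of vertices.\<close>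

definition weight :: "(nat \<times> 'k) list \<Rightarrow> nat" where
  "weight xs = length xs + sum_list (map fst xs)"

definition weight_gf :: "(nat \<times> 'k) list set \<Rightarrow> rat fps" where
  "weight_gf L = Abs_fps (\<lambda>n. of_nat (card {xs \<in> L. weight xs = n}))"

lemma finite_weight: "finite {xs :: (nat \<times> 'k::finite) list. weight xs = n}"
proof (rule finite_subset)
  show "{xs :: (nat \<times> 'k) list. weight xs = n} \<subseteq> {xs. set xs \<subseteq> {..n} \<times> UNIV \<and> length xs \<le> n}"
  proof safe
    fix xs :: "(nat \<times> 'k) list" and a k assume "(a, k) \<in> set xs" "n = weight xs"
    then have "a \<le> sum_list (map fst xs)" by (intro member_le_sum_list) force+
    then show "a \<le> weight xs" by (simp add: weight_def)
  qed (simp_all add: weight_def)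
  show "finite {xs :: (nat \<times> 'k) list. set xs \<subseteq> {..n} \<times> UNIV \<and> length xs \<le> n}"
    by (rule finite_lists_length_le) simp
qed

lemma finite_weight_in: "finite {xs \<in> (L :: (nat \<times> 'k::finite) list set). weight xs = n}"
  by (rule finite_subset[OF _ finite_weight[of n]]) auto

lemma weight_gf_UN_disjoint:
  fixes L :: "'q \<Rightarrow> (nat \<times> 'k::finite) list set"
  assumes "finite Q" "\<And>q q'. q \<in> Q \<Longrightarrow> q' \<in> Q \<Longrightarrow> q \<noteq> q' \<Longrightarrow> L q \<inter> L q' = {}"
  shows "weight_gf (\<Union>q\<in>Q. L q) = (\<Sum>q\<in>Q. weight_gf (L q))"
proof (rule fps_ext)
  fix n
  have "{xs \<in> \<Union>q\<in>Q. L q. weight xs = n} = (\<Union>q\<in>Q. {xs \<in> L q. weight xs = n})" by auto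
  then have "card {xs \<in> \<Union>q\<in>Q. L q. weight xs = n} = (\<Sum>q\<in>Q. card {xs \<in> L q. weight xs = n})"
    using assms by (simp only:) (rule card_UN_disjoint, use finite_weight_in in auto)
  then show "fps_nth (weight_gf (\<Union>q\<in>Q. L q)) n = fps_nth (\<Sum>q\<in>Q. weight_gf (L q)) n"
    by (simp add: weight_gf_def fps_sum_nth)
qed

text \<open>Either \<open>c\<close> is minimal, or decreasing it by one gives a word of the same kind of weight one less.\<close>

lemma weight_gf_Cons:
  fixes L :: "(nat \<times> 'k::finite) list set"
  shows "(1 - fps_X) * weight_gf {(c, k) # ys | c ys. l \<le> c \<and> ys \<in> L} = fps_X ^ Suc l * weight_gf L"
    (is "(1 - fps_X) * weight_gf ?C = _")
proof (rule fps_ext)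
  fix n
  define N where "N n = card {xs \<in> ?C. weight xs = n}" for n
  let ?hd = "if Suc l \<le> n then card {ys \<in> L. weight ys = n - Suc l} else 0"
  let ?U = "(\<lambda>ys. (l, k) # ys) ` {ys \<in> L. Suc l \<le> n \<and> weight ys = n - Suc l}"
  let ?W = "if n = 0 then {} else (\<lambda>xs. (Suc (fst (hd xs)), k) # tl xs) ` {xs \<in> ?C. weight xs = n - 1}"
  have split: "{xs \<in> ?C. weight xs = n} = ?U \<union> ?W"
  proof (rule set_eqI)
    fix xs
    have "xs \<in> {xs \<in> ?C. weight xs = n} \<longleftrightarrow> (\<exists>c ys. xs = (c, k) # ys \<and> l \<le> c \<and> ys \<in> L \<and> Suc (c + weight ys) = n)"
      by (auto simp: weight_def)
    also have "\<dots> \<longleftrightarrow> (\<exists>ys. xs = (l, k) # ys \<and> ys \<in> L \<and> Suc (l + weight ys) = n) \<or>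
        (\<exists>c ys. xs = (Suc c, k) # ys \<and> l \<le> c \<and> ys \<in> L \<and> Suc (Suc c + weight ys) = n)"
      (is "?lhs \<longleftrightarrow> ?rhs")
    proof
      assume ?lhs
      then obtain c ys where *: "xs = (c, k) # ys" "l \<le> c" "ys \<in> L" "Suc (c + weight ys) = n" by blast
      show ?rhs
      proof (cases "c = l")
        case False
        then obtain c' where "c = Suc c'" "l \<le> c'" using *(2) by (cases c) auto
        then show ?thesis using * by blast
      qed (use * in blast)
    next
      assume ?rhs
      then show ?lhs
      proof
        assume "\<exists>c ys. xs = (Suc c, k) # ys \<and> l \<le> c \<and> ys \<in> L \<and> Suc (Suc c + weight ys) = n"
        then show ?thesis using le_SucI by blast
      qed blast
    qed
    also have "(\<exists>ys. xs = (l, k) # ys \<and> ys \<in> L \<and> Suc (l + weight ys) = n) \<longleftrightarrow> xs \<in> ?U" by auto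
    also have "(\<exists>c ys. xs = (Suc c, k) # ys \<and> l \<le> c \<and> ys \<in> L \<and> Suc (Suc c + weight ys) = n) \<longleftrightarrow> xs \<in> ?W"
      by (cases n) (auto simp: weight_def image_iff; force)+
    finally show "xs \<in> {xs \<in> ?C. weight xs = n} \<longleftrightarrow> xs \<in> ?U \<union> ?W" by simp
  qed
  have "?U \<inter> ?W = {}" by auto
  moreover have "finite ?U"
    by (rule finite_imageI, rule finite_subset[OF _ finite_weight_in[of L "n - Suc l"]]) auto
  moreover have "finite ?W" using finite_weight_in[of ?C "n - 1"] by auto
  ultimately have "N n = card ?U + card ?W" unfolding N_def split by (rule card_Un_disjoint[rotated 2])
  also have "card ?U = ?hd" by (subst card_image) auto
  also have "card ?W = (if n = 0 then 0 else N (n - 1))"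
    by (auto simp: N_def intro!: card_image inj_onI)
  finally have Nn: "N n = ?hd + (if n = 0 then 0 else N (n - 1))" .
  then show "fps_nth ((1 - fps_X) * weight_gf ?C) n = fps_nth (fps_X ^ Suc l * weight_gf L) n"
  proof -
    have "fps_nth (weight_gf ?C) i = of_nat (N i)" for i by (simp only: weight_gf_def N_def fps_nth_Abs_fps)
    moreover have "fps_nth (weight_gf L) i = of_nat (card {ys \<in> L. weight ys = i})" for i
      by (simp add: weight_gf_def)
    moreover have "(1 - fps_X) * F = F - fps_X * F" for F :: "rat fps" by (simp add: algebra_simps)
    ultimately show ?thesis
      using Nn by (simp add: fps_X_power_mult_nth fps_X_mult_nth del: power_Suc)
  qed
qed

text \<open>\<open>adm k q\<close> allows \<open>q\<close> to follow \<open>k\<close>, and \<open>lo p k q\<close> is the smallest number that may accompany the letter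
\<open>k\<close> between \<open>p\<close> and \<open>q\<close>. Beyond its end, a word is continued by \<open>zero\<close>, which stands for the value
\<open>\<tau> m = 0\<close>.\<close>

locale letter_chains =
  fixes zero :: "'k::finite" and adm :: "'k \<Rightarrow> 'k \<Rightarrow> bool" and lo :: "'k \<Rightarrow> 'k \<Rightarrow> 'k \<Rightarrow> nat"
begin

definition letter :: "(nat \<times> 'k) list \<Rightarrow> nat \<Rightarrow> 'k" where
  "letter xs k = (if k < length xs then snd (xs ! k) else zero)"

definition chain :: "'k \<Rightarrow> (nat \<times> 'k) list \<Rightarrow> bool" where
  "chain p xs \<longleftrightarrow> (\<forall>k<length xs. adm (letter xs k) (letter xs (Suc k)) \<and>
     lo (if k = 0 then p else letter xs (k - 1)) (letter xs k) (letter xs (Suc k)) \<le> fst (xs ! k))"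

definition chains :: "'k \<Rightarrow> 'k \<Rightarrow> (nat \<times> 'k) list set" where
  "chains p k = {xs. xs \<noteq> [] \<and> letter xs 0 = k \<and> chain p xs}"

lemma letter_Cons: "letter (a # ys) 0 = snd a" "letter (a # ys) (Suc k) = letter ys k"
  by (auto simp: letter_def)

lemma chain_Nil: "chain p []" by (simp add: chain_def)

lemma chain_Cons:
  "chain p (a # ys) \<longleftrightarrow> adm (snd a) (letter ys 0) \<and> lo p (snd a) (letter ys 0) \<le> fst a \<and> chain (snd a) ys"
proof -
  have *: "(\<forall>k<Suc n. Q k) \<longleftrightarrow> Q 0 \<and> (\<forall>k<n. Q (Suc k))" for Q and n :: nat
    by (metis Suc_less_eq less_Suc_eq_0_disj)
  have prev: "letter (a # ys) k = (if k = 0 then snd a else letter ys (k - 1))" for k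
    by (cases k) (auto simp: letter_Cons)
  show ?thesis unfolding chain_def length_Cons * by (auto simp: letter_Cons prev)
qed

text \<open>Split off the first letter and distinguish by the second one; the summand \<open>of_bool (q = zero)\<close> is the
empty rest.\<close>

lemma chains_gf:
  "(1 - fps_X) * weight_gf (chains p k) =
     (\<Sum>q\<in>{q. adm k q}. fps_X ^ Suc (lo p k q) * (weight_gf (chains k q) + of_bool (q = zero)))"
proof -
  define Y where "Y q = {ys. letter ys 0 = q \<and> chain k ys}" for q
  define L where "L q = {(c, k) # ys | c ys. lo p k q \<le> c \<and> ys \<in> Y q}" for q
  have "chains p k = (\<Union>q\<in>{q. adm k q}. L q)"
  proof (rule set_eqI)
    fix xs show "xs \<in> chains p k \<longleftrightarrow> xs \<in> (\<Union>q\<in>{q. adm k q}. L q)"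
      by (cases xs) (auto simp: chains_def L_def Y_def letter_Cons chain_Cons)
  qed
  moreover have "L q \<inter> L q' = {}" if "q \<noteq> q'" for q q' using that by (auto simp: L_def Y_def)
  ultimately have "weight_gf (chains p k) = (\<Sum>q\<in>{q. adm k q}. weight_gf (L q))"
    using weight_gf_UN_disjoint[of "{q. adm k q}" L] by simp
  then have "(1 - fps_X) * weight_gf (chains p k) = (\<Sum>q\<in>{q. adm k q}. fps_X ^ Suc (lo p k q) * weight_gf (Y q))"
    unfolding L_def by (simp only: sum_distrib_left weight_gf_Cons)
  moreover have "weight_gf (Y q) = weight_gf (chains k q) + of_bool (q = zero)" for q
  proof (rule fps_ext)
    fix n
    have "{xs \<in> Y q. weight xs = n} = {xs \<in> chains k q. weight xs = n} \<union> (if q = zero \<and> n = 0 then {[]} else {})"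
      by (auto simp: Y_def chains_def letter_def weight_def chain_Nil)
    moreover have "{xs \<in> chains k q. weight xs = n} \<inter> (if q = zero \<and> n = 0 then {[]} else {}) = {}"
      by (auto simp: chains_def)
    ultimately have "card {xs \<in> Y q. weight xs = n} = card {xs \<in> chains k q. weight xs = n} + of_bool (q = zero \<and> n = 0)"
      by (simp add: card_Un_disjoint finite_weight_in)
    then show "fps_nth (weight_gf (Y q)) n = fps_nth (weight_gf (chains k q) + of_bool (q = zero)) n"
      by (simp add: weight_gf_def of_bool_def)
  qed
  ultimately show ?thesis by simp
qed

end

section \<open>Isomorphism classes as words\<close>

text \<open>How \<open>\<tau> k\<close> compares with \<open>k\<close>: no vertex is in deficit at \<open>k\<close>, or the degree of the vertex in deficit is
larger than \<open>k\<close>, equal to \<open>k\<close>, or smaller than \<open>k\<close>.\<close>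

datatype kind = Off | Ahead | Here | Behind

lemma UNIV_kind: "(UNIV :: kind set) = {Off, Ahead, Here, Behind}"
  using kind.exhaust by auto

instance kind :: finite
  by standard (simp add: UNIV_kind)

definition kind_of :: "nat \<Rightarrow> nat \<Rightarrow> kind" where
  "kind_of k t = (if t = 0 then Off else if k < t then Ahead else if t = k then Here else Behind)"

definition kind_adm :: "kind \<Rightarrow> kind \<Rightarrow> bool" where
  "kind_adm k q \<longleftrightarrow> (case k of Off \<Rightarrow> q \<noteq> Behind | Ahead \<Rightarrow> q = Ahead \<or> q = Here | _ \<Rightarrow> True)"

text \<open>The bounds that make \<open>slack\<close> nonnegative, increased by one wherever equality would violate the
order of ties, and raised to at least \<open>1\<close> at \<open>Here\<close>, where a vertex of that degree must exist; see
\<open>kind_lo_iff\<close>.\<close>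

definition kind_lo :: "kind \<Rightarrow> kind \<Rightarrow> kind \<Rightarrow> nat" where
  "kind_lo p k q = (case k of
     Off \<Rightarrow> 0
   | Ahead \<Rightarrow> (if p = Ahead then 0 else if p = Off then 2 else 1)
   | Here \<Rightarrow> (if q = Off then (if p = Ahead then 1 else 2) else 1)
   | Behind \<Rightarrow> (if q = Off then 1 else 0))"

lemma kind_of_iff [simp]:
  "kind_of k t = Off \<longleftrightarrow> t = 0" "kind_of k t = Ahead \<longleftrightarrow> k < t" "kind_of k t = Here \<longleftrightarrow> 0 < t \<and> t = k"
  "kind_of k t = Behind \<longleftrightarrow> 0 < t \<and> t < k"
  by (auto simp: kind_of_def)

lemma kind_adm_of_track:
  assumes "swap_track m \<tau>"
  shows "kind_adm (kind_of k (\<tau> k)) (kind_of (Suc k) (\<tau> (Suc k)))"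
proof -
  define x y where "x = \<tau> k" and "y = \<tau> (Suc k)"
  have 1: "k < x \<Longrightarrow> y = x" and 2: "0 < y \<Longrightarrow> y < Suc k \<Longrightarrow> x = y"
    using assms unfolding swap_track_def x_def y_def by metis+
  have "kind_adm (kind_of k x) (kind_of (Suc k) y)"
  proof (cases "kind_of k x")
    case Off
    then have "x = 0" by simp
    then show ?thesis unfolding kind_adm_def Off using 2 by auto
  next
    case Ahead
    then have "y = x" "k < x" using 1 by auto
    then show ?thesis unfolding kind_adm_def Ahead by auto
  qed (unfold kind_adm_def, simp_all only: kind.case)
  then show ?thesis by (simp add: x_def y_def)
qed

lemma kind_lo_kind_of:
  "kind_lo (kind_of k x) (kind_of (Suc k) y) (kind_of l z) =
    (if y = 0 then 0
     else if Suc k < y then (if k < x then 0 else if x = 0 then 2 else 1)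
     else if y = Suc k then (if z = 0 \<and> x \<le> k then 2 else 1)
     else if z = 0 then 1 else 0)"
proof -
  consider "y = 0" | "Suc k < y" | "y = Suc k" | "0 < y" "y < Suc k" by linarith
  then show ?thesis
  proof cases
    case 1
    then have kind: "kind_of (Suc k) y = Off" by simp
    show ?thesis unfolding kind_lo_def kind using 1 by simp
  next
    case 2
    then have kind: "kind_of (Suc k) y = Ahead" by simp
    show ?thesis unfolding kind_lo_def kind using 2 by simp
  next
    case 3
    then have kind: "kind_of (Suc k) y = Here" by simp
    show ?thesis unfolding kind_lo_def kind using 3 by simp
  next
    case 4
    then have kind: "kind_of (Suc k) y = Behind" by simp
    show ?thesis unfolding kind_lo_def kind using 4 by simp
  qed
qed

text \<open>A case distinction on the values \<open>x, y, z\<close> of \<open>\<tau>\<close> at \<open>k\<close>, \<open>k + 1\<close> and \<open>k + 2\<close>. The number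
\<open>x\<close> is \<open>0\<close>, equal to \<open>y\<close> or at most \<open>k\<close>, and \<open>z\<close> is \<open>0\<close>, equal to \<open>y\<close> or at least \<open>k + 2\<close>. The product in
\<open>tie_slack\<close> is harmless, as it matters only for \<open>slack c \<tau> k = 0\<close>, where \<open>c (k + 1)\<close> is at most \<open>2\<close>.\<close>

lemma kind_lo_iff:
  assumes "swap_track m \<tau>"
  shows "kind_lo (kind_of k (\<tau> k)) (kind_of (Suc k) (\<tau> (Suc k))) (kind_of (Suc (Suc k)) (\<tau> (Suc (Suc k)))) \<le> c (Suc k)
    \<longleftrightarrow> 0 \<le> slack c \<tau> k \<and> (slack c \<tau> k = 0 \<longrightarrow> 0 \<le> tie_slack c \<tau> k) \<and> (\<tau> (Suc k) = Suc k \<longrightarrow> 0 < c (Suc k))"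
proof -
  define x y z n where "x = \<tau> k" and "y = \<tau> (Suc k)" and "z = \<tau> (Suc (Suc k))" and "n = c (Suc k)"
  have 1: "k < x \<Longrightarrow> y = x" "0 < y \<Longrightarrow> y < Suc k \<Longrightarrow> x = y" "Suc k < y \<Longrightarrow> z = y"
    "0 < z \<Longrightarrow> z < Suc (Suc k) \<Longrightarrow> y = z"
    using assms unfolding swap_track_def x_def y_def z_def by metis+
  have "y = 0 \<or> (Suc k < y \<and> z = y) \<or> y = Suc k \<or> (0 < y \<and> y \<le> k \<and> x = y)" using 1(2,3) by linarith
  moreover have "x = 0 \<or> (k < x \<and> x = y) \<or> (0 < x \<and> x \<le> k)" using 1(1) by linarith
  moreover have "z = 0 \<or> z = y \<or> Suc (Suc k) \<le> z" using 1(4) by linarith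
  moreover have "n = 0 \<or> n = 1 \<or> n = 2 \<or> 3 \<le> n" by linarith
  ultimately have "kind_lo (kind_of k x) (kind_of (Suc k) y) (kind_of (Suc (Suc k)) z) \<le> n \<longleftrightarrow>
      0 \<le> int n + of_bool (x \<noteq> 0) + of_bool (z \<noteq> 0) - 2 * of_bool (y \<noteq> 0) \<and>
      (int n + of_bool (x \<noteq> 0) + of_bool (z \<noteq> 0) - 2 * of_bool (y \<noteq> 0) = 0 \<longrightarrow>
       0 \<le> int (Suc k * n) + int x + int z - 2 * int y) \<and> (y = Suc k \<longrightarrow> 0 < n)"
    unfolding kind_lo_kind_of
    by - (elim disjE conjE; simp)
  then show ?thesis
    by (simp only: slack_def tie_slack_def x_def y_def z_def n_def)
qed

text \<open>At \<open>Ahead\<close> the value is the position of the next \<open>Here\<close>, at \<open>Behind\<close> it is the position of the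
previous one.\<close>

lemma track_of_kinds:
  assumes K0: "K 0 = Off" and Km: "\<And>k. m \<le> k \<Longrightarrow> K k = Off" and adm: "\<And>k. k < m \<Longrightarrow> kind_adm (K k) (K (Suc k))"
  obtains \<tau> where "swap_track m \<tau>" "\<And>k. kind_of k (\<tau> k) = K k"
proof -
  have adm: "kind_adm (K k) (K (Suc k))" for k
    by (cases "k < m") (use adm Km in \<open>auto simp: kind_adm_def\<close>)
  define before where "before = rec_nat 0 (\<lambda>k b. if K (Suc k) = Here then Suc k else b)"
  define after where "after k = (LEAST l. k \<le> l \<and> K l \<noteq> Ahead)" for k
  define \<tau> where "\<tau> k = (case K k of Off \<Rightarrow> 0 | Ahead \<Rightarrow> after k | Here \<Rightarrow> k | Behind \<Rightarrow> before k)" for k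
  have before_Suc: "before (Suc k) = (if K (Suc k) = Here then Suc k else before k)" for k
    by (simp add: before_def)
  have before: "before k \<le> k \<and> (K k = Here \<longrightarrow> before k = k \<and> 0 < k) \<and> (K k = Behind \<longrightarrow> 0 < before k \<and> before k < k)" for k
  proof (induction k)
    case 0
    then show ?case using K0 by (simp add: before_def)
  next
    case (Suc k)
    then show ?case using adm[of k] by (auto simp: before_Suc kind_adm_def split: kind.splits)
  qed
  have after_step: "after k = (if K k = Ahead then after (Suc k) else k)" for k
  proof (cases "K k = Ahead")
    case True
    have "k \<le> l \<and> K l \<noteq> Ahead \<longleftrightarrow> Suc k \<le> l \<and> K l \<noteq> Ahead" for l using True by (cases "l = k") auto
    then show ?thesis using True by (simp add: after_def)
  next
    case False
    then show ?thesis unfolding after_def by (auto intro!: Least_equality)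
  qed
  have after_ge: "k \<le> after k" for k
  proof -
    have "k \<le> max k m \<and> K (max k m) \<noteq> Ahead" using Km[of "max k m"] by simp
    then have "k \<le> after k \<and> K (after k) \<noteq> Ahead" unfolding after_def by (rule LeastI)
    then show ?thesis ..
  qed
  show thesis
  proof (rule that)
    have gt: "k < after k" if "K k = Ahead" for k
      using after_step[of k] after_ge[of "Suc k"] that by simp
    show "kind_of k (\<tau> k) = K k" for k
      using before[of k] gt[of k] gr_implies_not0[of k "after k"] by (cases "K k") (auto simp: \<tau>_def kind_of_def)
    show "swap_track m \<tau>" unfolding swap_track_def
    proof (intro conjI allI impI)
      show "\<tau> 0 = 0" by (simp add: \<tau>_def K0)
      show "\<tau> k = 0" if "m \<le> k" for k using Km[OF that] by (simp add: \<tau>_def)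
      show "\<tau> (Suc k) = \<tau> k" if "k < \<tau> k" for k
      proof -
        have "K k = Ahead" using that before[of k] by (cases "K k") (auto simp: \<tau>_def)
        then have "\<tau> k = after (Suc k)" "K (Suc k) = Ahead \<or> K (Suc k) = Here"
          using adm[of k] after_step[of k] by (auto simp: \<tau>_def kind_adm_def)
        then show ?thesis using after_step[of "Suc k"] by (auto simp: \<tau>_def)
      qed
      show "\<tau> k = \<tau> (Suc k)" if "0 < \<tau> (Suc k) \<and> \<tau> (Suc k) < Suc k" for k
      proof -
        have "K (Suc k) = Behind" using that after_ge[of "Suc k"] by (cases "K (Suc k)") (auto simp: \<tau>_def)
        then have "\<tau> (Suc k) = before k" "K k = Here \<or> K k = Behind"
          using adm[of k] by (auto simp: \<tau>_def before_Suc kind_adm_def split: kind.splits)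
        then show ?thesis using before[of k] by (auto simp: \<tau>_def)
      qed
    qed
  qed
qed

lemma track_determined_by_kinds:
  assumes t: "swap_track m \<tau>" and t': "swap_track m \<tau>'"
    and eq: "\<And>k. kind_of k (\<tau> k) = kind_of k (\<tau>' k)"
  shows "\<tau> = \<tau>'"
proof -
  have up: "k < \<tau> k \<Longrightarrow> \<tau> (Suc k) = \<tau> k" "k < \<tau>' k \<Longrightarrow> \<tau>' (Suc k) = \<tau>' k"
    and down: "0 < \<tau> (Suc k) \<Longrightarrow> \<tau> (Suc k) < Suc k \<Longrightarrow> \<tau> k = \<tau> (Suc k)"
      "0 < \<tau>' (Suc k) \<Longrightarrow> \<tau>' (Suc k) < Suc k \<Longrightarrow> \<tau>' k = \<tau>' (Suc k)"
    and large: "m \<le> k \<Longrightarrow> \<tau> k = 0 \<and> \<tau>' k = 0" for k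
    using t t' unfolding swap_track_def by metis+
  have small_eq: "\<tau> k = \<tau>' k" if "\<tau> k \<le> k" for k
    using that
  proof (induction k)
    case 0
    then show ?case using eq[of 0] by (auto simp: kind_of_def split: if_splits)
  next
    case (Suc k)
    have "kind_of (Suc k) (\<tau> (Suc k)) = kind_of (Suc k) (\<tau>' (Suc k))" by (rule eq)
    then consider "\<tau> (Suc k) = \<tau>' (Suc k)" | "0 < \<tau> (Suc k)" "\<tau> (Suc k) < Suc k" "0 < \<tau>' (Suc k)" "\<tau>' (Suc k) < Suc k"
      using Suc.prems by (auto simp: kind_of_def split: if_splits)
    then show ?case
    proof cases
      case 2
      then show ?thesis using down[of k] Suc.IH by simp
    qed
  qed
  have "\<tau> k = \<tau>' k" for k
  proof (cases "k \<le> m")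
    case True
    then show ?thesis
    proof (induction k rule: inc_induct)
      case base
      then show ?case using large by simp
    next
      case (step n)
      show ?case
      proof (cases "\<tau> n \<le> n")
        case False
        then have "n < \<tau> n" "n < \<tau>' n" using eq[of n] by (auto simp: kind_of_def split: if_splits)
        then show ?thesis using up step.IH by simp
      qed (rule small_eq)
    qed
  qed (use large in simp)
  then show ?thesis by blast
qed

interpretation W: letter_chains Off kind_adm kind_lo .

lemma weight_eq_sum: "weight xs = length xs + (\<Sum>t<length xs. fst (xs ! t))"
  by (simp add: weight_def sum_list_sum_nth lessThan_atLeast0)

lemma canonical_model_of_code:
  assumes xs: "xs \<in> W.chains Off Off"
  shows "\<exists>(G :: nat ugraph) c \<tau> \<alpha> P. canonical_model G (length xs) c \<tau> \<alpha> P
    \<and> (\<forall>t<length xs. c t = fst (xs ! t)) \<and> (\<forall>k. kind_of k (\<tau> k) = W.letter xs k)"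
proof -
  define m where "m = length xs"
  define c where "c t = fst (xs ! t)" for t
  have m: "0 < m" and K0: "W.letter xs 0 = Off" and ch: "W.chain Off xs" using xs by (auto simp: W.chains_def m_def)
  have Km: "W.letter xs k = Off" if "m \<le> k" for k using that by (simp add: W.letter_def m_def)
  have adm: "kind_adm (W.letter xs k) (W.letter xs (Suc k))" if "k < m" for k
    using ch that by (simp add: W.chain_def m_def)
  have lo: "kind_lo (W.letter xs k) (W.letter xs (Suc k)) (W.letter xs (Suc (Suc k))) \<le> c (Suc k)" if "Suc k < m" for k
    using ch[unfolded W.chain_def, rule_format, of "Suc k"] that by (simp add: m_def c_def)
  obtain \<tau> where tr: "swap_track m \<tau>" and K: "\<And>k. kind_of k (\<tau> k) = W.letter xs k"
    using track_of_kinds[of "W.letter xs" m, OF K0 Km adm] by blast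
  note iff = kind_lo_iff[OF tr, of _ c, unfolded K]
  have c: "0 < c t" if "0 < t" "\<tau> t = t" for t
  proof -
    have "t < m" using tr that unfolding swap_track_def by (metis not_le less_numeral_extra(3))
    then show ?thesis using lo[of "t - 1"] iff[of "t - 1"] that by simp
  qed
  obtain G :: "nat ugraph" and \<alpha> P where M: "degree_sorted_model G m c \<tau> \<alpha> P"
  proof (rule degree_sorted_model_exists[OF m tr, of c])
    show "0 < c t" if "0 < t" "\<tau> t = t" for t by (rule c[OF that])
    show "0 \<le> slack c \<tau> k" if "Suc k < m" for k using lo[OF that] iff by blast
  qed (rule that)
  then have "canonical_model G m c \<tau> \<alpha> P"
    by (rule canonical_model.intro) (unfold_locales, use lo iff in auto)
  then show ?thesis using K unfolding m_def c_def by blast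
qed

lemma code_of_canonical_model:
  assumes "canonical_model G m c \<tau> \<alpha> P"
  shows "\<exists>xs\<in>W.chains Off Off. length xs = m \<and> (\<forall>t<m. c t = fst (xs ! t)) \<and> (\<forall>k. kind_of k (\<tau> k) = W.letter xs k)"
proof -
  interpret canonical_model G m c \<tau> \<alpha> P by fact
  define xs where "xs = map (\<lambda>k. (c k, kind_of k (\<tau> k))) [0..<m]"
  have len: "length xs = m" by (simp add: xs_def)
  have \<tau>0: "\<tau> 0 = 0" and \<tau>m: "\<And>k. m \<le> k \<Longrightarrow> \<tau> k = 0" using track unfolding swap_track_def by metis+
  have K: "W.letter xs k = kind_of k (\<tau> k)" for k using \<tau>m[of k] by (auto simp: W.letter_def xs_def kind_of_def)
  have cx: "fst (xs ! t) = c t" if "t < m" for t using that by (simp add: xs_def)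
  have K0: "W.letter xs 0 = Off" by (simp add: K \<tau>0 kind_of_def)
  have c_pos: "0 < c t" if "0 < t" "\<tau> t = t" "t < m" for t
  proof -
    have "t \<in> degree G ` P" unfolding P_deg using that by simp
    then obtain u where u: "u \<in> P" "degree G u = t" by blast
    then have "u \<in> {u \<in> B. degree G u = t}" using P_sub by auto
    then have "card {u \<in> B. degree G u = t} \<noteq> 0" using fin by auto
    then show ?thesis using count[OF that(3)] by simp
  qed
  have "W.chain Off xs" unfolding W.chain_def
  proof (intro allI impI conjI)
    fix k assume k: "k < length xs"
    show "kind_adm (W.letter xs k) (W.letter xs (Suc k))" unfolding K by (rule kind_adm_of_track[OF track])
    show "kind_lo (if k = 0 then Off else W.letter xs (k - 1)) (W.letter xs k) (W.letter xs (Suc k)) \<le> fst (xs ! k)"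
    proof (cases k)
      case 0
      then show ?thesis by (simp add: K0 kind_lo_def)
    next
      case (Suc j)
      then show ?thesis using kind_lo_iff[OF track, of j c] room[of j] tie[of j] c_pos[of "Suc j"] k len cx[of k]
        by (simp add: K)
    qed
  qed
  then have "xs \<in> W.chains Off Off" using K0 m_pos len by (auto simp: W.chains_def)
  then show ?thesis using len K cx by auto
qed

lemma card_quotient_by_representatives:
  assumes R: "equiv S R" and rep: "\<And>x. x \<in> C \<Longrightarrow> rep x \<in> S"
    and inj: "\<And>x y. x \<in> C \<Longrightarrow> y \<in> C \<Longrightarrow> (rep x, rep y) \<in> R \<Longrightarrow> x = y"
    and surj: "\<And>s. s \<in> S \<Longrightarrow> \<exists>x\<in>C. (rep x, s) \<in> R"
  shows "card (S // R) = card C"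
proof -
  have "bij_betw (\<lambda>x. R `` {rep x}) C (S // R)"
  proof (rule bij_betwI')
    fix x y assume xy: "x \<in> C" "y \<in> C"
    show "R `` {rep x} = R `` {rep y} \<longleftrightarrow> x = y" using eq_equiv_class_iff[OF R rep rep, OF xy] inj[OF xy] by auto
  next
    fix x assume "x \<in> C"
    then show "R `` {rep x} \<in> S // R" using rep by (auto intro: quotientI)
  next
    fix Y assume "Y \<in> S // R"
    then obtain s where s: "s \<in> S" "Y = R `` {s}" by (auto elim: quotientE)
    then obtain x where "x \<in> C" "(rep x, s) \<in> R" using surj by blast
    then show "\<exists>x\<in>C. Y = R `` {rep x}" using equiv_class_eq[OF R] s by blast
  qed
  then show ?thesis by (metis bij_betw_same_card)
qed

text \<open>Each word is sent to a canonical model with its data. By \<open>graph_iso_determines_track\<close> different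
words give nonisomorphic graphs, and by \<open>weakly_threshold_graph_model\<close> and \<open>graph_iso_of_data\<close> every
weakly threshold graph is isomorphic to one of these models.\<close>

lemma num_wt_graphs_eq: "num_wt_graphs n = card {xs \<in> W.chains Off Off. weight xs = n}"
proof -
  let ?R = "{(G, H). G \<in> wt_graphs n \<and> H \<in> wt_graphs n \<and> graph_iso G H}"
  let ?C = "{xs \<in> W.chains Off Off. weight xs = n}"
  obtain rep :: "(nat \<times> kind) list \<Rightarrow> nat ugraph" where rep: "\<And>xs. xs \<in> W.chains Off Off \<Longrightarrow>
      \<exists>c \<tau> \<alpha> P. canonical_model (rep xs) (length xs) c \<tau> \<alpha> P
        \<and> (\<forall>t<length xs. c t = fst (xs ! t)) \<and> (\<forall>k. kind_of k (\<tau> k) = W.letter xs k)"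
    using canonical_model_of_code by metis
  have size: "card (verts G) = weight xs" if "canonical_model G (length xs) c \<tau> \<alpha> P" "\<forall>t<length xs. c t = fst (xs ! t)"
    for G :: "nat ugraph" and xs :: "(nat \<times> kind) list" and c \<tau> \<alpha> P
  proof -
    interpret canonical_model G "length xs" c \<tau> \<alpha> P by fact
    show ?thesis using length_deg_seq that(2) by (simp add: length_deg_seq_verts weight_eq_sum)
  qed
  show ?thesis unfolding num_wt_graphs_def
  proof (rule card_quotient_by_representatives)
    show "equiv (wt_graphs n) ?R"
      by (auto simp: equiv_def refl_on_def sym_def trans_def intro: graph_iso_refl graph_iso_sym graph_iso_trans)
    show "rep xs \<in> wt_graphs n" if xs: "xs \<in> ?C" for xs
    proof -
      have "xs \<in> W.chains Off Off" using xs by blast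
      then obtain c \<tau> \<alpha> P where M: "canonical_model (rep xs) (length xs) c \<tau> \<alpha> P"
        and c: "\<forall>t<length xs. c t = fst (xs ! t)" using rep by blast
      have "weakly_threshold_graph (rep xs)"
        by (rule degree_sorted_model_weakly_threshold[OF canonical_model.axioms(1)[OF M]])
      then show ?thesis using size[OF M c] xs by (simp add: wt_graphs_def)
    qed
    show "xs = ys" if xs: "xs \<in> ?C" and ys: "ys \<in> ?C" and iso: "(rep xs, rep ys) \<in> ?R" for xs ys
    proof -
      have xsW: "xs \<in> W.chains Off Off" and ysW: "ys \<in> W.chains Off Off" using xs ys by blast+
      obtain c \<tau> \<alpha> P where M: "canonical_model (rep xs) (length xs) c \<tau> \<alpha> P"
        "\<forall>t<length xs. c t = fst (xs ! t)" "\<forall>k. kind_of k (\<tau> k) = W.letter xs k" using rep xsW by blast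
      obtain c' \<tau>' \<beta> Q where M': "canonical_model (rep ys) (length ys) c' \<tau>' \<beta> Q"
        "\<forall>t<length ys. c' t = fst (ys ! t)" "\<forall>k. kind_of k (\<tau>' k) = W.letter ys k" using rep ysW by blast
      have "graph_iso (rep xs) (rep ys)" using iso by blast
      note det = graph_iso_determines_track[OF M(1) M'(1) this]
      show ?thesis
      proof (rule nth_equalityI)
        show "length xs = length ys" by (rule det(1))
        fix k assume k: "k < length xs"
        have "fst (xs ! k) = fst (ys ! k)" using det(1,2) M(2) M'(2) k by metis
        moreover have "W.letter xs k = W.letter ys k" using M(3) M'(3) det(3) by metis
        then have "snd (xs ! k) = snd (ys ! k)" using k det(1) by (simp add: W.letter_def)
        ultimately show "xs ! k = ys ! k" by (rule prod_eqI)
      qed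
    qed
    show "\<exists>xs\<in>?C. (rep xs, G) \<in> ?R" if G: "G \<in> wt_graphs n" for G
    proof -
      have wt: "weakly_threshold_graph G" and n: "card (verts G) = n" using G by (auto simp: wt_graphs_def)
      obtain m c \<tau> \<alpha> P where M: "canonical_model G m c \<tau> \<alpha> P" using weakly_threshold_graph_model[OF wt] .
      obtain xs where xs: "xs \<in> W.chains Off Off" "length xs = m" "\<forall>t<m. c t = fst (xs ! t)"
        "\<forall>k. kind_of k (\<tau> k) = W.letter xs k" using code_of_canonical_model[OF M] by blast
      obtain c' \<tau>' \<beta> Q where M': "canonical_model (rep xs) (length xs) c' \<tau>' \<beta> Q"
        "\<forall>t<length xs. c' t = fst (xs ! t)" "\<forall>k. kind_of k (\<tau>' k) = W.letter xs k" using rep[OF xs(1)] by blast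
      interpret G: canonical_model G m c \<tau> \<alpha> P by fact
      interpret H: canonical_model "rep xs" "length xs" c' \<tau>' \<beta> Q by fact
      have "\<tau>' = \<tau>" by (rule track_determined_by_kinds[of m]) (use G.track H.track xs M' in auto)
      then have "swap_model (rep xs) m c' \<tau> \<beta> Q" using H.swap_model_axioms xs(2) by simp
      then have iso: "graph_iso (rep xs) G"
        by (rule graph_iso_of_data[OF _ G.swap_model_axioms]) (use xs M' in auto)
      have w: "weight xs = n" using size[of G xs c \<tau> \<alpha> P] M xs n by simp
      have "rep xs \<in> wt_graphs n"
        using degree_sorted_model_weakly_threshold[OF H.degree_sorted_model_axioms] size[OF M'(1,2)] w
        by (simp add: wt_graphs_def)
      then show ?thesis using iso G xs(1) w by blast
    qed
  qed
qed

section \<open>Weakly threshold sequences as words\<close>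

text \<open>For sequences the letters are the bits \<open>\<tau> k \<noteq> 0\<close>, and the bound is nonnegativity of \<open>slack\<close>.\<close>

interpretation S: letter_chains False "\<lambda>_ _. True" "\<lambda>p k q. 2 * of_bool k - (of_bool p + of_bool q)" .

text \<open>Given the bits, a possible \<open>\<tau>\<close> takes on each maximal run of ones the first position of the run. The
bound at that position provides the vertex of \<open>B\<close> with this degree.\<close>

lemma degree_sorted_model_of_code:
  assumes xs: "xs \<in> S.chains False False"
  shows "\<exists>(G :: nat ugraph) c \<tau> \<alpha> P. degree_sorted_model G (length xs) c \<tau> \<alpha> P
    \<and> (\<forall>t<length xs. c t = fst (xs ! t)) \<and> (\<forall>k. \<tau> k \<noteq> 0 \<longleftrightarrow> S.letter xs k)"
proof -
  define m where "m = length xs"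
  define c where "c t = fst (xs ! t)" for t
  define \<tau> where "\<tau> = rec_nat 0 (\<lambda>k t. if S.letter xs (Suc k) then (if t = 0 then Suc k else t) else 0)"
  have \<tau>0: "\<tau> 0 = 0" and \<tau>_Suc: "\<And>k. \<tau> (Suc k) = (if S.letter xs (Suc k) then (if \<tau> k = 0 then Suc k else \<tau> k) else 0)"
    by (simp_all add: \<tau>_def)
  have m: "0 < m" and b0: "\<not> S.letter xs 0" and ch: "S.chain False xs" using xs by (auto simp: S.chains_def m_def)
  have le: "\<tau> k \<le> k" for k by (induction k) (auto simp: \<tau>0 \<tau>_Suc)
  have bit: "\<tau> k \<noteq> 0 \<longleftrightarrow> S.letter xs k" for k by (cases k) (auto simp: \<tau>0 \<tau>_Suc b0)
  have "\<tau> k = 0" if "m \<le> k" for k using bit[of k] that by (auto simp: S.letter_def m_def)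
  then have tr: "swap_track m \<tau>" unfolding swap_track_def
    using le by (auto simp: \<tau>0 \<tau>_Suc not_less split: if_splits)
  have lo: "2 * of_bool (\<tau> (Suc k) \<noteq> 0) \<le> c (Suc k) + of_bool (\<tau> k \<noteq> 0) + of_bool (\<tau> (Suc (Suc k)) \<noteq> 0)" if "Suc k < m" for k
    using ch[unfolded S.chain_def, rule_format, of "Suc k"] that unfolding bit by (simp add: m_def c_def)
  have room: "0 \<le> slack c \<tau> k" if "Suc k < m" for k using lo[OF that] by (auto simp: slack_def)
  have c: "0 < c t" if "0 < t" "\<tau> t = t" for t
  proof -
    obtain j where j: "t = Suc j" using gr0_implies_Suc[OF \<open>0 < t\<close>] by blast
    have "t < m" using \<open>\<And>k. m \<le> k \<Longrightarrow> \<tau> k = 0\<close>[of t] that by (cases "m \<le> t") auto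
    moreover have "\<tau> j = 0" using that le[of j] \<tau>_Suc[of j] by (auto simp: j split: if_splits)
    ultimately show ?thesis using lo[of j] that by (auto simp: j of_bool_def split: if_splits)
  qed
  obtain G :: "nat ugraph" and \<alpha> P where M: "degree_sorted_model G m c \<tau> \<alpha> P"
  proof (rule degree_sorted_model_exists[OF m tr, of c])
    show "0 < c t" if "0 < t" "\<tau> t = t" for t by (rule c[OF that])
    show "0 \<le> slack c \<tau> k" if "Suc k < m" for k by (rule room[OF that])
  qed (rule that)
  then show ?thesis using bit unfolding m_def c_def by blast
qed

lemma code_of_degree_sorted_model:
  assumes "degree_sorted_model G m c \<tau> \<alpha> P"
  shows "\<exists>xs\<in>S.chains False False. length xs = m \<and> (\<forall>t<m. c t = fst (xs ! t)) \<and> (\<forall>k. \<tau> k \<noteq> 0 \<longleftrightarrow> S.letter xs k)"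
proof -
  interpret degree_sorted_model G m c \<tau> \<alpha> P by fact
  define xs where "xs = map (\<lambda>k. (c k, \<tau> k \<noteq> 0)) [0..<m]"
  have len: "length xs = m" by (simp add: xs_def)
  have \<tau>0: "\<tau> 0 = 0" and \<tau>m: "\<And>k. m \<le> k \<Longrightarrow> \<tau> k = 0" using track unfolding swap_track_def by metis+
  have bit: "S.letter xs k \<longleftrightarrow> \<tau> k \<noteq> 0" for k using \<tau>m[of k] by (auto simp: S.letter_def xs_def)
  have cx: "fst (xs ! t) = c t" if "t < m" for t using that by (simp add: xs_def)
  have "S.chain False xs" unfolding S.chain_def
  proof (intro allI impI conjI)
    fix k assume k: "k < length xs"
    show "2 * of_bool (S.letter xs k) - (of_bool (if k = 0 then False else S.letter xs (k - 1)) + of_bool (S.letter xs (Suc k))) \<le> fst (xs ! k)"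
    proof (cases k)
      case 0
      then show ?thesis by (simp add: bit \<tau>0)
    next
      case (Suc j)
      then show ?thesis using room[of j] k len cx[of k] by (auto simp: bit slack_def of_bool_def split: if_splits)
    qed
  qed simp
  then have "xs \<in> S.chains False False" using bit[of 0] \<tau>0 m_pos len by (auto simp: S.chains_def)
  then show ?thesis using len bit cx by auto
qed

lemma num_wt_seqs_eq: "num_wt_seqs n = card {xs \<in> S.chains False False. weight xs = n}"
proof -
  let ?C = "{xs \<in> S.chains False False. weight xs = n}"
  obtain rep :: "(nat \<times> bool) list \<Rightarrow> nat ugraph" where rep: "\<And>xs. xs \<in> S.chains False False \<Longrightarrow>
      \<exists>c \<tau> \<alpha> P. degree_sorted_model (rep xs) (length xs) c \<tau> \<alpha> P
        \<and> (\<forall>t<length xs. c t = fst (xs ! t)) \<and> (\<forall>k. \<tau> k \<noteq> 0 \<longleftrightarrow> S.letter xs k)"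
    using degree_sorted_model_of_code by metis
  have size: "length (deg_seq G) = weight xs" if "degree_sorted_model G (length xs) c \<tau> \<alpha> P" "\<forall>t<length xs. c t = fst (xs ! t)"
    for G :: "nat ugraph" and xs :: "(nat \<times> bool) list" and c \<tau> \<alpha> P
    using degree_sorted_model.length_deg_seq[OF that(1)] that(2) by (simp add: weight_eq_sum)
  have "bij_betw (\<lambda>xs. deg_seq (rep xs)) ?C {d. weakly_threshold_seq d \<and> length d = n}"
  proof (rule bij_betwI')
    fix xs ys assume xs: "xs \<in> ?C" and ys: "ys \<in> ?C"
    have xsW: "xs \<in> S.chains False False" and ysW: "ys \<in> S.chains False False" using xs ys by blast+
    obtain c \<tau> \<alpha> P where M: "degree_sorted_model (rep xs) (length xs) c \<tau> \<alpha> P"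
      "\<forall>t<length xs. c t = fst (xs ! t)" "\<forall>k. \<tau> k \<noteq> 0 \<longleftrightarrow> S.letter xs k" using rep xsW by blast
    obtain c' \<tau>' \<beta> Q where M': "degree_sorted_model (rep ys) (length ys) c' \<tau>' \<beta> Q"
      "\<forall>t<length ys. c' t = fst (ys ! t)" "\<forall>k. \<tau>' k \<noteq> 0 \<longleftrightarrow> S.letter ys k" using rep ysW by blast
    show "deg_seq (rep xs) = deg_seq (rep ys) \<longleftrightarrow> xs = ys"
    proof
      assume "deg_seq (rep xs) = deg_seq (rep ys)"
      note det = deg_seq_determines_data[OF M(1) M'(1) this]
      show "xs = ys"
      proof (rule nth_equalityI)
        show "length xs = length ys" by (rule det(1))
        fix k assume k: "k < length xs"
        have "fst (xs ! k) = fst (ys ! k)" using det(1,2) M(2) M'(2) k by metis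
        moreover have "S.letter xs k = S.letter ys k" using M(3) M'(3) det(3) by metis
        then have "snd (xs ! k) = snd (ys ! k)" using k det(1) by (simp add: S.letter_def)
        ultimately show "xs ! k = ys ! k" by (rule prod_eqI)
      qed
    qed simp
  next
    fix xs assume xs: "xs \<in> ?C"
    then have "xs \<in> S.chains False False" by blast
    then obtain c \<tau> \<alpha> P where M: "degree_sorted_model (rep xs) (length xs) c \<tau> \<alpha> P"
      and c: "\<forall>t<length xs. c t = fst (xs ! t)" using rep by blast
    show "deg_seq (rep xs) \<in> {d. weakly_threshold_seq d \<and> length d = n}"
      using degree_sorted_model_weakly_threshold[OF M] size[OF M c] xs by (simp add: weakly_threshold_graph_def)
  next
    fix d assume d: "d \<in> {d. weakly_threshold_seq d \<and> length d = n}"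
    then obtain G :: "nat ugraph" where G: "simple_graph G" "deg_seq G = d"
      by (auto simp: weakly_threshold_seq_def degree_sequence_def)
    then have "weakly_threshold_graph G" using d by (simp add: weakly_threshold_graph_def)
    then obtain m c \<tau> \<alpha> P where "canonical_model G m c \<tau> \<alpha> P" using weakly_threshold_graph_model by blast
    then have M: "degree_sorted_model G m c \<tau> \<alpha> P" by (rule canonical_model.axioms(1))
    obtain xs where xs: "xs \<in> S.chains False False" "length xs = m" "\<forall>t<m. c t = fst (xs ! t)"
      "\<forall>k. \<tau> k \<noteq> 0 \<longleftrightarrow> S.letter xs k" using code_of_degree_sorted_model[OF M] by blast
    obtain c' \<tau>' \<beta> Q where M': "degree_sorted_model (rep xs) (length xs) c' \<tau>' \<beta> Q"
      "\<forall>t<length xs. c' t = fst (xs ! t)" "\<forall>k. \<tau>' k \<noteq> 0 \<longleftrightarrow> S.letter xs k" using rep[OF xs(1)] by blast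
    have "\<tau> k = 0 \<longleftrightarrow> \<tau>' k = 0" for k using xs(4) M'(3) by blast
    then have "deg_seq G = deg_seq (rep xs)"
      by (intro deg_seq_eq_of_data[OF M M'(1)[unfolded xs(2)]]) (use xs(2,3) M'(2) in auto)
    moreover have "weight xs = n" using size[of G xs c \<tau> \<alpha> P] M xs d G by simp
    ultimately show "\<exists>xs\<in>?C. d = deg_seq (rep xs)" using G xs(1) by auto
  qed
  from bij_betw_same_card[OF this] show ?thesis unfolding num_wt_seqs_def by (rule sym)
qed

section \<open>Solving the linear systems\<close>

lemma (in letter_chains) Abs_fps_chains:
  "Abs_fps (\<lambda>n. if 1 \<le> n then of_nat (card {xs \<in> chains p k. weight xs = n}) else 0) = weight_gf (chains p k)"
proof (rule fps_ext)
  fix n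
  have "{xs \<in> chains p k. weight xs = 0} = {}" by (auto simp: chains_def weight_def)
  then have "card {xs \<in> chains p k. weight xs = 0} = 0" by (simp only: card.empty)
  then show "fps_nth (Abs_fps (\<lambda>n. if 1 \<le> n then of_nat (card {xs \<in> chains p k. weight xs = n}) else 0)) n = fps_nth (weight_gf (chains p k)) n"
    by (cases n) (simp_all add: weight_gf_def)
qed

lemma S_gf_mult: "S_gf * (1 - 3 * fps_X + fps_X^2 + fps_X^3) = fps_X - fps_X^2 - fps_X^3"
proof -
  define X where "X = (fps_X :: rat fps)"
  define F where "F p k = weight_gf (S.chains p k)" for p k
  have gf: "(1 - X) * F p k = X ^ Suc (2 * of_bool k - (of_bool p + of_bool False)) * (F k False + 1)
      + X ^ Suc (2 * of_bool k - (of_bool p + of_bool True)) * F k True" for p k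
    using S.chains_gf[of p k] by (simp add: F_def X_def UNIV_bool)
  have X1: "1 - X \<noteq> 0" by (rule notI, drule arg_cong[of _ _ "\<lambda>f. fps_nth f 0"], simp add: X_def)
  \<comment> \<open>The letter before a zero bit does not influence the bound, so one unknown can be dropped.\<close>
  have "(1 - X) * F True False = (1 - X) * F False False" unfolding gf by simp
  then have TF: "F True False = F False False" using X1 by simp
  define s a b where "s = F False False" and "a = F False True" and "b = F True True"
  have e1: "(1 - X) * s = X * (s + 1) + X * a" using gf[of False False] by (simp add: s_def a_def)
  have e2: "(1 - X) * a = X^3 * (s + 1) + X^2 * b"
    using gf[of False True] TF by (simp add: s_def a_def b_def power3_eq_cube power2_eq_square mult.assoc)
  have e3: "(1 - X) * b = X^2 * (s + 1) + X * b"
    using gf[of True True] TF by (simp add: s_def b_def power2_eq_square mult.assoc)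
  have "(1 - X) * ((1 - 2 * X) * a) = (1 - X) * (X^3 * (s + 1))" using e2 e3 by algebra
  then have "(1 - 2 * X) * a = X^3 * (s + 1)" using X1 by simp
  then have "(1 - X) * ((1 - 3 * X + X^2 + X^3) * s) = (1 - X) * (X - X^2 - X^3)" using e1 by algebra
  then have "s * (1 - 3 * X + X^2 + X^3) = X - X^2 - X^3" using X1 by (simp add: mult.commute)
  moreover have "S_gf = s" unfolding S_gf_def num_wt_seqs_eq S.Abs_fps_chains s_def F_def ..
  ultimately show ?thesis by (simp add: X_def)
qed

lemma kind_adm_sets:
  "{q. kind_adm Off q} = {Off, Ahead, Here}" "{q. kind_adm Ahead q} = {Ahead, Here}"
  "{q. kind_adm Here q} = {Off, Ahead, Here, Behind}" "{q. kind_adm Behind q} = {Off, Ahead, Here, Behind}"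
proof -
  have "{q. Q q} = {q \<in> {Off, Ahead, Here, Behind}. Q q}" for Q using UNIV_kind by auto
  note * = this[of "kind_adm _"]
  show "{q. kind_adm Off q} = {Off, Ahead, Here}" "{q. kind_adm Ahead q} = {Ahead, Here}"
    "{q. kind_adm Here q} = {Off, Ahead, Here, Behind}" "{q. kind_adm Behind q} = {Off, Ahead, Here, Behind}"
    by (subst *, force simp: kind_adm_def)+
qed

lemma W_gf_mult: "W_gf * (1 - 4 * fps_X + 3 * fps_X^2 + fps_X^3 + fps_X^5) = fps_X - 2 * fps_X^2 - fps_X^3 - fps_X^5"
proof -
  define X where "X = (fps_X :: rat fps)"
  define F where "F p k = weight_gf (W.chains p k)" for p k
  have gf: "(1 - X) * F p k = (\<Sum>q\<in>{q. kind_adm k q}. X ^ Suc (kind_lo p k q) * (F k q + of_bool (q = Off)))" for p k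
    unfolding F_def X_def by (rule W.chains_gf)
  have X1: "1 - X \<noteq> 0" by (rule notI, drule arg_cong[of _ _ "\<lambda>f. fps_nth f 0"], simp add: X_def)
  note sets = kind_adm_sets kind_lo_def
  have eqs: "(1 - X) * F p Off = X * (F Off Off + 1) + X * F Off Ahead + X * F Off Here"
    "(1 - X) * F Off Ahead = X^3 * (F Ahead Ahead + F Ahead Here)"
    "(1 - X) * F Ahead Ahead = X * (F Ahead Ahead + F Ahead Here)"
    "(1 - X) * F Here Ahead = X^2 * (F Ahead Ahead + F Ahead Here)"
    "(1 - X) * F Behind Ahead = X^2 * (F Ahead Ahead + F Ahead Here)"
    "(1 - X) * F Off Here = X^3 * (F Here Off + 1) + X^2 * (F Here Behind + F Here Here + F Here Ahead)"
    "(1 - X) * F Ahead Here = X^2 * (F Here Off + 1) + X^2 * (F Here Behind + F Here Here + F Here Ahead)"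
    "(1 - X) * F Here Here = X^3 * (F Here Off + 1) + X^2 * (F Here Behind + F Here Here + F Here Ahead)"
    "(1 - X) * F Behind Here = X^3 * (F Here Off + 1) + X^2 * (F Here Behind + F Here Here + F Here Ahead)"
    "(1 - X) * F Here Behind = X^2 * (F Behind Off + 1) + X * (F Behind Behind + F Behind Here + F Behind Ahead)"
    "(1 - X) * F Behind Behind = X^2 * (F Behind Off + 1) + X * (F Behind Behind + F Behind Here + F Behind Ahead)" for p
    unfolding gf kind_adm_sets by (simp_all add: kind_lo_def algebra_simps power2_eq_square power3_eq_cube)
  have cancel: "f = g" if "(1 - X) * f = (1 - X) * g" for f g using that X1 by simp
  have same: "F Here Off = F Off Off" "F Behind Off = F Off Off" "F Behind Ahead = F Here Ahead" "F Behind Here = F Here Here" "F Behind Behind = F Here Behind"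
    by (rule cancel, simp only: eqs)+
  \<comment> \<open>After identifying unknowns with equal equations, three combinations close up: words that start with
    \<open>Off\<close>, words preceded by \<open>Ahead\<close>, and words preceded by \<open>Here\<close> that do not start with \<open>Off\<close>.\<close>
  define w r s where "w = F Off Off" and "r = F Ahead Ahead + F Ahead Here" and "s = F Here Behind + F Here Here + F Here Ahead"
  note eqs = eqs(1)[of Off] eqs(2-)[unfolded same]
  note eqs = eqs[folded w_def r_def s_def]
  have e1: "(1 - 2 * X) * r = X^2 * (w + 1 + s)"
  proof -
    have "(1 - X) * r = X * r + X^2 * (w + 1) + X^2 * s"
      unfolding r_def distrib_left[of "1 - X"] eqs(3,7)[folded r_def] by (simp add: r_def)
    then show ?thesis by algebra
  qed
  have e2: "(1 - 2 * X - X^2) * s = (X^2 + X^3) * (w + 1) + X^2 * r"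
  proof -
    have "(1 - X) * s = (X^2 * (w + 1) + X * s) + (X^3 * (w + 1) + X^2 * s) + X^2 * r"
      unfolding s_def distrib_left[of "1 - X"] by (simp only: eqs[unfolded s_def])
    then show ?thesis by algebra
  qed
  have e3: "(1 - X)^2 * w = (1 - X) * X * (w + 1) + X^4 * (w + 1) + X^3 * s + X^4 * r"
    using eqs(1,2,6) by algebra
  \<comment> \<open>The factor \<open>K\<close> appears on both sides when \<open>r\<close> and \<open>s\<close> are eliminated.\<close>
  define K where "K = 1 - 5 * X + 8 * X^2 - 3 * X^3 - 3 * X^4 + 2 * X^5"
  have "K * (w * (1 - 4 * X + 3 * X^2 + X^3 + X^5)) = K * (X - 2 * X^2 - X^3 - X^5)"
    unfolding K_def using e1 e2 e3 by algebra
  moreover have "K \<noteq> 0"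
    by (rule notI, drule arg_cong[of _ _ "\<lambda>f. fps_nth f 0"]) (simp add: K_def X_def numeral_fps_const)
  ultimately have "w * (1 - 4 * X + 3 * X^2 + X^3 + X^5) = X - 2 * X^2 - X^3 - X^5" by simp
  moreover have "W_gf = w" unfolding W_gf_def num_wt_graphs_eq W.Abs_fps_chains w_def F_def ..
  ultimately show ?thesis by (simp add: X_def)
qed

lemma fps_divide_mult_unit:
  fixes d :: "rat fps"
  assumes "fps_nth d 0 \<noteq> 0"
  shows "a / d * d = a"
proof -
  have "d dvd a" using assms by (meson fps_is_unit_iff unit_imp_dvd)
  then show ?thesis by simp
qed

theorem theorem5p7:
  shows "S_gf = (fps_X - fps_X^2 - fps_X^3) / (1 - 3 * fps_X + fps_X^2 + fps_X^3)
    \<and> S_gf = -1 + 1 / (2 * (1 - fps_X)) + (1 - fps_X) / (2 * (1 - 2 * fps_X - fps_X^2))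
    \<and> W_gf = (fps_X - 2 * fps_X^2 - fps_X^3 - fps_X^5)
              / (1 - 4 * fps_X + 3 * fps_X^2 + fps_X^3 + fps_X^5)
    \<and> W_gf = -1 + 2 / (3 * (1 - fps_X - fps_X^2))
              + (1 - 2 * fps_X) / (3 * (1 - 3 * fps_X + fps_X^2 - fps_X^3))"
proof -
  define X where "X = (fps_X :: rat fps)"
  have nz: "d \<noteq> 0" if "fps_nth d 0 \<noteq> 0" for d :: "rat fps" using that by auto
  have c0: "fps_nth (numeral k) 0 = (numeral k :: rat)" for k by (simp add: numeral_fps_const)
  have S: "S_gf * (1 - 3 * X + X^2 + X^3) = X - X^2 - X^3" using S_gf_mult by (simp add: X_def)
  have W: "W_gf * (1 - 4 * X + 3 * X^2 + X^3 + X^5) = X - 2 * X^2 - X^3 - X^5" using W_gf_mult by (simp add: X_def)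
  have div: "f = n / d" if "f * d = n" "fps_nth d 0 \<noteq> 0" for f n d :: "rat fps"
    using that nz[OF that(2)] by (metis nonzero_mult_div_cancel_right)
  have "S_gf = (X - X^2 - X^3) / (1 - 3 * X + X^2 + X^3)"
    by (rule div[OF S]) (simp add: X_def)
  moreover have "W_gf = (X - 2 * X^2 - X^3 - X^5) / (1 - 4 * X + 3 * X^2 + X^3 + X^5)"
    by (rule div[OF W]) (simp add: X_def)
  moreover have "S_gf = -1 + 1 / (2 * (1 - X)) + (1 - X) / (2 * (1 - 2 * X - X^2))"
  proof -
    define p q where "p = 1 / (2 * (1 - X))" and "q = (1 - X) / (2 * (1 - 2 * X - X^2))"
    have p: "p * (2 * (1 - X)) = 1" and q: "q * (2 * (1 - 2 * X - X^2)) = 1 - X"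
      unfolding p_def q_def by (rule fps_divide_mult_unit, simp add: X_def c0)+
    have "S_gf * (2 * (1 - 3 * X + X^2 + X^3)) = (-1 + p + q) * (2 * (1 - 3 * X + X^2 + X^3))"
      using S p q by algebra
    moreover have "2 * (1 - 3 * X + X^2 + X^3) \<noteq> 0" by (rule nz) (simp add: X_def c0)
    ultimately show ?thesis unfolding p_def[symmetric] q_def[symmetric] using mult_right_cancel by blast
  qed
  moreover have "W_gf = -1 + 2 / (3 * (1 - X - X^2)) + (1 - 2 * X) / (3 * (1 - 3 * X + X^2 - X^3))"
  proof -
    define p q where "p = 2 / (3 * (1 - X - X^2))" and "q = (1 - 2 * X) / (3 * (1 - 3 * X + X^2 - X^3))"
    have p: "p * (3 * (1 - X - X^2)) = 2" and q: "q * (3 * (1 - 3 * X + X^2 - X^3)) = 1 - 2 * X"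
      unfolding p_def q_def by (rule fps_divide_mult_unit, simp add: X_def c0)+
    have "W_gf * (3 * (1 - 4 * X + 3 * X^2 + X^3 + X^5)) = (-1 + p + q) * (3 * (1 - 4 * X + 3 * X^2 + X^3 + X^5))"
      using W p q by algebra
    moreover have "3 * (1 - 4 * X + 3 * X^2 + X^3 + X^5) \<noteq> 0" by (rule nz) (simp add: X_def c0)
    ultimately show ?thesis unfolding p_def[symmetric] q_def[symmetric] using mult_right_cancel by blast
  qed
  ultimately show ?thesis unfolding X_def by blast
qed

end
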